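(* Let $\Lambda$ be an action operad and $X$ a (small) category. The free $\Lambda$-monoidal category $E\Lambda(X)$ generated by $X$ is isomorphic to a category with - object set $\coprod_{n\in\mathbb N}(\mathrm{ob}\,X)^n$, and - morphism sets $$E\Lambda(X)\big((x_1,\dots,x_m),(y_1,\dots,y_n)\big)=\begin{cases}\emptyset,& m\neq n,\\ \coprod_{g\in\Lambda(n)}\prod_{i=1}^nX(x_i,y_{g(i)}),& m=n.\end{cases}$$
   Context: $\mathbb N\ni 0$; permutations compose as functions. A (non-symmetric) operad $O$ in sets: sets $O(n)$ ($n\in\mathbb N$), $\mathrm{id}\in O(1)$, functions $\mu:O(n)\times O(k_1)\times\cdots\times O(k_n)\to O(k_1+\cdots+k_n)$, unital and associative in the usual sense; maps preserve $\mathrm{id}$ and $\mu$. The operad $\Sigma$ of symmetric groups has $\mu(\sigma;\tau_1,\dots,\tau_n)=\delta(\sigma)\cdot\beta(\tau_1,\dots,\tau_n)$, with $\beta$ the block sum of the permutations $\tau_i\in\Sigma_{k_i}$ and $\delta(\sigma)=\delta_{n;k_1,\dots,k_n}(\sigma)$ sending $k_1+\cdots+k_{i-1}+a$ ($1\le a\le k_i$) to $(\sum_{\sigma(i')<\sigma(i)}k_{i'})+a$. An action operad $(\Lambda,\pi)$: an operad $\Lambda$ in sets with a group structure on each $\Lambda(n)$ and a map of operads $\pi:\Lambda\to\Sigma$ whose components are group homomorphisms, such that, writing $g(i)=\pi_n(g)(i)$ and $g^{-1}(i)=\pi_n(g)^{-1}(i)$, $\mu(g';f_1',\dots,f_n')\mu(g;f_1,\dots,f_n)=\mu(g'g;f'_{g(1)}f_1,\dots,f'_{g(n)}f_n)$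 for $g,g'\in\Lambda(n)$, $f_i\in\Lambda(k_i)$, $f_i'\in\Lambda(k_{g^{-1}(i)})$. $E\Lambda$ is the operad in $\mathbf{Cat}$ where $E\Lambda(n)$ is the category with object set $\Lambda(n)$ and exactly one morphism between any two objects, with operad structure given on objects by that of $\Lambda$, and with the right action of the group $\Lambda(n)$ by right multiplication. A $\Lambda$-monoidal category is a strict algebra for $E\Lambda$, equivalently a strict algebra for the 2-monad $\underline{E\Lambda}$ on $\mathbf{Cat}$ with $\underline{E\Lambda}(X)=\coprod_nE\Lambda(n)\otimes_{\Lambda(n)}X^n$, unit $x\mapsto[e_1;x]$ and multiplication induced by the operad multiplication. Here $\Lambda(n)$ acts on the left of $X^n$ by $g\cdot(x_1,\dots,x_n)=(x_{g^{-1}(1)},\dots,x_{g^{-1}(n)})$ and $E\Lambda(n)\otimes_{\Lambda(n)}X^n$ is the coequalizer in $\mathbf{Cat}$ of the two functors $E\Lambda(n)\times\Lambda(n)\times X^n\rightrightarrows E\Lambda(n)\times X^n$, $(p,g,\underline x)\mapsto(p\cdot g,\underline x)$ and $(p,g,\underline x)\mapsto(p,g\cdot\underline x)$ ($\Lambda(n)$ a discrete category). $E\Lambda(X)$ denotes the free algebra $\underline{E\Lambda}(X)$. *)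

theory Defs
  imports "HOL-Algebra.Group" "HOL-Combinatorics.Permutations"
begin

text \<open>
  Tuples $(x_1,\dots,x_n)$ are lists, so all indices are shifted to run over
  $0,\dots,n-1$; accordingly $\Sigma_n$ consists of the permutations of \<^term>\<open>{..<n}\<close>.
\<close>

section \<open>Operads and action operads\<close>

text \<open>
  The sets \<^term>\<open>Ops L n\<close> need not be disjoint for different \<open>n\<close>, so the composition
  takes the arities as an additional argument:
  \<open>Mu L [k\<^sub>1, \<dots>, k\<^sub>n] g [f\<^sub>1, \<dots>, f\<^sub>n]\<close> is $\mu(g;f_1,\dots,f_n)$
  for $g\in O(n)$ and $f_i\in O(k_i)$.
\<close>

record 'a operad =
  Ops :: "nat \<Rightarrow> 'a set"
  Unit :: "'a"
  Mu :: "nat list \<Rightarrow> 'a \<Rightarrow> 'a list \<Rightarrow> 'a"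

definition ops_list :: "'a operad \<Rightarrow> nat list \<Rightarrow> 'a list \<Rightarrow> bool" where
  "ops_list L ks fs \<longleftrightarrow> list_all2 (\<lambda>k f. f \<in> Ops L k) ks fs"

locale operad =
  fixes L :: "'a operad"
  assumes unit_closed: "Unit L \<in> Ops L 1"
    and mu_closed:
      "\<lbrakk>g \<in> Ops L (length ks); ops_list L ks fs\<rbrakk> \<Longrightarrow> Mu L ks g fs \<in> Ops L (sum_list ks)"
    and unit_left: "f \<in> Ops L k \<Longrightarrow> Mu L [k] (Unit L) [f] = f"
    and unit_right: "g \<in> Ops L n \<Longrightarrow> Mu L (replicate n 1) g (replicate n (Unit L)) = g"
    and mu_assoc:
      "\<lbrakk>g \<in> Ops L (length lss); ops_list L (map length lss) fs; list_all2 (ops_list L) lss hss\<rbrakk> \<Longrightarrow>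
        Mu L (concat lss) (Mu L (map length lss) g fs) (concat hss) =
        Mu L (map sum_list lss) g (map (\<lambda>(ls, f, hs). Mu L ls f hs) (zip lss (zip fs hss)))"

definition operad_map :: "'a operad \<Rightarrow> 'b operad \<Rightarrow> (nat \<Rightarrow> 'a \<Rightarrow> 'b) \<Rightarrow> bool" where
  "operad_map L M \<phi> \<longleftrightarrow>
    (\<forall>n. \<forall>g\<in>Ops L n. \<phi> n g \<in> Ops M n) \<and>
    \<phi> 1 (Unit L) = Unit M \<and>
    (\<forall>ks g fs. g \<in> Ops L (length ks) \<longrightarrow> ops_list L ks fs \<longrightarrow>
      \<phi> (sum_list ks) (Mu L ks g fs) = Mu M ks (\<phi> (length ks) g) (map2 \<phi> ks fs))"

definition perm_group :: "nat \<Rightarrow> (nat \<Rightarrow> nat) monoid" where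
  "perm_group n = \<lparr>carrier = {p. p permutes {..<n}}, monoid.mult = (\<circ>), one = id\<rparr>"

text \<open>\<open>block_pos ks p\<close> is the unique \<open>(i, a)\<close> with \<open>p = k\<^sub>0 + \<dots> + k\<^sub>i\<^sub>-\<^sub>1 + a\<close> and \<open>a < k\<^sub>i\<close>,
  provided that \<open>p < sum_list ks\<close>.\<close>

fun block_pos :: "nat list \<Rightarrow> nat \<Rightarrow> nat \<times> nat" where
  "block_pos [] p = (0, p)"
| "block_pos (k # ks) p =
    (if p < k then (0, p) else (let (i, a) = block_pos ks (p - k) in (Suc i, a)))"

definition block_perm :: "nat list \<Rightarrow> (nat \<Rightarrow> nat) \<Rightarrow> nat \<Rightarrow> nat" where
  "block_perm ks \<sigma> p =
    (if p < sum_list ks then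
       (let (i, a) = block_pos ks p in (\<Sum>j | j < length ks \<and> \<sigma> j < \<sigma> i. ks ! j) + a)
     else p)"

definition block_sum :: "nat list \<Rightarrow> (nat \<Rightarrow> nat) list \<Rightarrow> nat \<Rightarrow> nat" where
  "block_sum ks \<tau>s p =
    (if p < sum_list ks then
       (let (i, a) = block_pos ks p in sum_list (take i ks) + (\<tau>s ! i) a)
     else p)"

definition sym_operad :: "(nat \<Rightarrow> nat) operad" where
  "sym_operad =
    \<lparr>Ops = (\<lambda>n. carrier (perm_group n)), Unit = id,
     Mu = (\<lambda>ks \<sigma> \<tau>s. block_perm ks \<sigma> \<circ> block_sum ks \<tau>s)\<rparr>"

lemma block_pos_unique:
  assumes "i < length ks" "a < ks ! i"
  shows "block_pos ks (sum_list (take i ks) + a) = (i, a)"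
    and "sum_list (take i ks) + a < sum_list ks"
proof -
  have "block_pos ks (sum_list (take i ks) + a) = (i, a) \<and>
        sum_list (take i ks) + a < sum_list ks"
    using assms
  proof (induction ks arbitrary: i)
    case (Cons k ks)
    then show ?case by (cases i) auto
  qed simp
  then show "block_pos ks (sum_list (take i ks) + a) = (i, a)"
    and "sum_list (take i ks) + a < sum_list ks" by auto
qed

lemma block_perm_apply:
  assumes "i < length ks" "a < ks ! i"
  shows "block_perm ks \<sigma> (sum_list (take i ks) + a) =
    (\<Sum>j | j < length ks \<and> \<sigma> j < \<sigma> i. ks ! j) + a"
  using block_pos_unique[OF assms] by (simp add: block_perm_def)

lemma block_sum_apply:
  assumes "i < length ks" "a < ks ! i"
  shows "block_sum ks \<tau>s (sum_list (take i ks) + a) = sum_list (take i ks) + (\<tau>s ! i) a"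
  using block_pos_unique[OF assms] by (simp add: block_sum_def)

text \<open>The left action $p\cdot(x_1,\dots,x_n)=(x_{p^{-1}(1)},\dots,x_{p^{-1}(n)})$.\<close>

definition perm_tuple :: "(nat \<Rightarrow> nat) \<Rightarrow> 'b list \<Rightarrow> 'b list" where
  "perm_tuple p xs = map (\<lambda>i. xs ! inv_into UNIV p i) [0..<length xs]"

text \<open>In the last axiom \<open>f'\<^sub>i\<close> has arity \<open>k\<^bsub>g\<^sup>-\<^sup>1(i)\<^esub>\<close>, i.e. the arities of \<open>fs'\<close> are the
  permuted tuple \<open>g \<cdot> ks\<close>.\<close>

locale action_operad = operad L
  for L :: "'a operad" +
  fixes \<Lambda> :: "nat \<Rightarrow> 'a monoid"
    and \<pi> :: "nat \<Rightarrow> 'a \<Rightarrow> nat \<Rightarrow> nat"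
  assumes group_\<Lambda>: "group (\<Lambda> n)"
    and carrier_\<Lambda>: "carrier (\<Lambda> n) = Ops L n"
    and \<pi>_operad_map: "operad_map L sym_operad \<pi>"
    and \<pi>_hom: "\<pi> n \<in> hom (\<Lambda> n) (perm_group n)"
    and mu_mult:
      "\<lbrakk>g \<in> Ops L (length ks); g' \<in> Ops L (length ks); ops_list L ks fs;
        ops_list L (perm_tuple (\<pi> (length ks) g) ks) fs'\<rbrakk> \<Longrightarrow>
        Mu L (perm_tuple (\<pi> (length ks) g) ks) g' fs' \<otimes>\<^bsub>\<Lambda> (sum_list ks)\<^esub> Mu L ks g fs =
        Mu L ks (g' \<otimes>\<^bsub>\<Lambda> (length ks)\<^esub> g)
          (map (\<lambda>i. fs' ! (\<pi> (length ks) g i) \<otimes>\<^bsub>\<Lambda> (ks ! i)\<^esub> fs ! i) [0..<length ks])"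


section \<open>Categories and functors\<close>

text \<open>
  Hom-sets belonging to different pairs of objects may overlap; hence composition and the
  action of a functor on morphisms take the objects as arguments. \<open>Comp C x y z g f\<close> is
  $g\circ f$ for $f\colon x\to y$ and $g\colon y\to z$.
\<close>

record ('o, 'm) cat =
  Ob :: "'o set"
  Mor :: "'o \<Rightarrow> 'o \<Rightarrow> 'm set"
  Ident :: "'o \<Rightarrow> 'm"
  Comp :: "'o \<Rightarrow> 'o \<Rightarrow> 'o \<Rightarrow> 'm \<Rightarrow> 'm \<Rightarrow> 'm"

locale category =
  fixes C :: "('o, 'm) cat"
  assumes Ident_closed: "x \<in> Ob C \<Longrightarrow> Ident C x \<in> Mor C x x"
    and Comp_closed:
      "\<lbrakk>x \<in> Ob C; y \<in> Ob C; z \<in> Ob C; f \<in> Mor C x y; g \<in> Mor C y z\<rbrakk> \<Longrightarrow>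
        Comp C x y z g f \<in> Mor C x z"
    and Comp_Ident_left:
      "\<lbrakk>x \<in> Ob C; y \<in> Ob C; f \<in> Mor C x y\<rbrakk> \<Longrightarrow> Comp C x y y (Ident C y) f = f"
    and Comp_Ident_right:
      "\<lbrakk>x \<in> Ob C; y \<in> Ob C; f \<in> Mor C x y\<rbrakk> \<Longrightarrow> Comp C x x y f (Ident C x) = f"
    and Comp_assoc:
      "\<lbrakk>w \<in> Ob C; x \<in> Ob C; y \<in> Ob C; z \<in> Ob C;
        f \<in> Mor C w x; g \<in> Mor C x y; h \<in> Mor C y z\<rbrakk> \<Longrightarrow>
        Comp C w x z (Comp C x y z h g) f = Comp C w y z h (Comp C w x y g f)"

record ('o, 'm, 'p, 'n) func =
  omap :: "'o \<Rightarrow> 'p"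
  mmap :: "'o \<Rightarrow> 'o \<Rightarrow> 'm \<Rightarrow> 'n"

locale cat_functor = C: category C + D: category D
  for C :: "('o, 'm) cat" and D :: "('p, 'n) cat" +
  fixes F :: "('o, 'm, 'p, 'n) func"
  assumes omap_closed: "x \<in> Ob C \<Longrightarrow> omap F x \<in> Ob D"
    and mmap_closed:
      "\<lbrakk>x \<in> Ob C; y \<in> Ob C; f \<in> Mor C x y\<rbrakk> \<Longrightarrow> mmap F x y f \<in> Mor D (omap F x) (omap F y)"
    and mmap_Ident: "x \<in> Ob C \<Longrightarrow> mmap F x x (Ident C x) = Ident D (omap F x)"
    and mmap_Comp:
      "\<lbrakk>x \<in> Ob C; y \<in> Ob C; z \<in> Ob C; f \<in> Mor C x y; g \<in> Mor C y z\<rbrakk> \<Longrightarrow>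
        mmap F x z (Comp C x y z g f) =
        Comp D (omap F x) (omap F y) (omap F z) (mmap F y z g) (mmap F x y f)"

definition func_id :: "('o, 'm, 'o, 'm) func" where
  "func_id = \<lparr>omap = (\<lambda>x. x), mmap = (\<lambda>x y f. f)\<rparr>"

definition func_comp ::
    "('p, 'n, 'q, 'l) func \<Rightarrow> ('o, 'm, 'p, 'n) func \<Rightarrow> ('o, 'm, 'q, 'l) func" where
  "func_comp G F =
    \<lparr>omap = (\<lambda>x. omap G (omap F x)),
     mmap = (\<lambda>x y f. mmap G (omap F x) (omap F y) (mmap F x y f))\<rparr>"

definition func_eq ::
    "('o, 'm) cat \<Rightarrow> ('o, 'm, 'p, 'n) func \<Rightarrow> ('o, 'm, 'p, 'n) func \<Rightarrow> bool" where
  "func_eq C F G \<longleftrightarrow>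
    (\<forall>x\<in>Ob C. omap F x = omap G x) \<and>
    (\<forall>x\<in>Ob C. \<forall>y\<in>Ob C. \<forall>f\<in>Mor C x y. mmap F x y f = mmap G x y f)"

definition cat_isomorphic :: "('o, 'm) cat \<Rightarrow> ('p, 'n) cat \<Rightarrow> bool" where
  "cat_isomorphic C D \<longleftrightarrow>
    (\<exists>F G. cat_functor C D F \<and> cat_functor D C G \<and>
      func_eq C (func_comp G F) func_id \<and> func_eq D (func_comp F G) func_id)"


section \<open>Constructions on categories\<close>

definition indiscrete_cat :: "'o set \<Rightarrow> ('o, unit) cat" where
  "indiscrete_cat A =
    \<lparr>Ob = A, Mor = (\<lambda>x y. {()}), Ident = (\<lambda>x. ()), Comp = (\<lambda>x y z g f. ())\<rparr>"

definition discrete_cat :: "'o set \<Rightarrow> ('o, unit) cat" where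
  "discrete_cat A =
    \<lparr>Ob = A, Mor = (\<lambda>x y. if x = y then {()} else {}), Ident = (\<lambda>x. ()),
     Comp = (\<lambda>x y z g f. ())\<rparr>"

definition prod_cat :: "('o, 'm) cat \<Rightarrow> ('p, 'n) cat \<Rightarrow> ('o \<times> 'p, 'm \<times> 'n) cat" where
  "prod_cat C D =
    \<lparr>Ob = Ob C \<times> Ob D,
     Mor = (\<lambda>(x, u) (y, v). Mor C x y \<times> Mor D u v),
     Ident = (\<lambda>(x, u). (Ident C x, Ident D u)),
     Comp = (\<lambda>(x, u) (y, v) (z, w) (g, k) (f, h). (Comp C x y z g f, Comp D u v w k h))\<rparr>"

definition power_cat :: "nat \<Rightarrow> ('o, 'm) cat \<Rightarrow> ('o list, 'm list) cat" where
  "power_cat n C =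
    \<lparr>Ob = {xs. length xs = n \<and> set xs \<subseteq> Ob C},
     Mor = (\<lambda>xs ys. {fs. length fs = n \<and> (\<forall>i<n. fs ! i \<in> Mor C (xs ! i) (ys ! i))}),
     Ident = map (Ident C),
     Comp = (\<lambda>xs ys zs gs fs.
       map (\<lambda>i. Comp C (xs ! i) (ys ! i) (zs ! i) (gs ! i) (fs ! i)) [0..<n])\<rparr>"

definition coprod_cat :: "('i \<Rightarrow> ('o, 'm) cat) \<Rightarrow> ('i \<times> 'o, 'm) cat" where
  "coprod_cat C =
    \<lparr>Ob = (SIGMA i:UNIV. Ob (C i)),
     Mor = (\<lambda>(i, x) (j, y). if i = j then Mor (C i) x y else {}),
     Ident = (\<lambda>(i, x). Ident (C i) x),
     Comp = (\<lambda>(i, x) (j, y) (k, z) g f. Comp (C i) x y z g f)\<rparr>"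


section \<open>Coequalizers in the category of categories\<close>

text \<open>
  For $F,G\colon A\to B$, the objects of the coequalizer are the classes of the equivalence
  relation on the objects of $B$ generated by $Fa\sim Ga$. Its morphisms are the
  paths, i.e. formal composites of morphisms of $B$ that are composable up to $\sim$, modulo the
  congruence generated by the identities and composites of $B$ and by $Fh\sim Gh$. A path is a
  list, in diagrammatic order, of morphisms recorded with their source and target. The universal
  property is proved below.
\<close>

inductive coeq_ob_eq ::
    "('o, 'm) cat \<Rightarrow> ('p, 'n) cat \<Rightarrow> ('o, 'm, 'p, 'n) func \<Rightarrow> ('o, 'm, 'p, 'n) func \<Rightarrow>
     'p \<Rightarrow> 'p \<Rightarrow> bool"
  for A B F G where
  ob_gen: "a \<in> Ob A \<Longrightarrow> coeq_ob_eq A B F G (omap F a) (omap G a)"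
| ob_refl: "x \<in> Ob B \<Longrightarrow> coeq_ob_eq A B F G x x"
| ob_sym: "coeq_ob_eq A B F G x y \<Longrightarrow> coeq_ob_eq A B F G y x"
| ob_trans: "\<lbrakk>coeq_ob_eq A B F G x y; coeq_ob_eq A B F G y z\<rbrakk> \<Longrightarrow> coeq_ob_eq A B F G x z"

definition coeq_ob ::
    "('o, 'm) cat \<Rightarrow> ('p, 'n) cat \<Rightarrow> ('o, 'm, 'p, 'n) func \<Rightarrow> ('o, 'm, 'p, 'n) func \<Rightarrow>
     'p \<Rightarrow> 'p set" where
  "coeq_ob A B F G x = {y. coeq_ob_eq A B F G x y}"

inductive coeq_path ::
    "('o, 'm) cat \<Rightarrow> ('p, 'n) cat \<Rightarrow> ('o, 'm, 'p, 'n) func \<Rightarrow> ('o, 'm, 'p, 'n) func \<Rightarrow>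
     'p set \<Rightarrow> 'p set \<Rightarrow> ('p \<times> 'n \<times> 'p) list \<Rightarrow> bool"
  for A B F G where
  path_Nil: "x \<in> Ob B \<Longrightarrow> coeq_path A B F G (coeq_ob A B F G x) (coeq_ob A B F G x) []"
| path_Cons:
    "\<lbrakk>x \<in> Ob B; y \<in> Ob B; f \<in> Mor B x y; coeq_path A B F G (coeq_ob A B F G y) d p\<rbrakk> \<Longrightarrow>
      coeq_path A B F G (coeq_ob A B F G x) d ((x, f, y) # p)"

inductive coeq_path_eq ::
    "('o, 'm) cat \<Rightarrow> ('p, 'n) cat \<Rightarrow> ('o, 'm, 'p, 'n) func \<Rightarrow> ('o, 'm, 'p, 'n) func \<Rightarrow>
     'p set \<Rightarrow> 'p set \<Rightarrow> ('p \<times> 'n \<times> 'p) list \<Rightarrow> ('p \<times> 'n \<times> 'p) list \<Rightarrow> bool"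
  for A B F G where
  path_gen:
    "\<lbrakk>a \<in> Ob A; b \<in> Ob A; h \<in> Mor A a b\<rbrakk> \<Longrightarrow>
      coeq_path_eq A B F G (coeq_ob A B F G (omap F a)) (coeq_ob A B F G (omap F b))
        [(omap F a, mmap F a b h, omap F b)] [(omap G a, mmap G a b h, omap G b)]"
| path_Ident:
    "x \<in> Ob B \<Longrightarrow>
      coeq_path_eq A B F G (coeq_ob A B F G x) (coeq_ob A B F G x) [(x, Ident B x, x)] []"
| path_Comp:
    "\<lbrakk>x \<in> Ob B; y \<in> Ob B; z \<in> Ob B; f \<in> Mor B x y; g \<in> Mor B y z\<rbrakk> \<Longrightarrow>
      coeq_path_eq A B F G (coeq_ob A B F G x) (coeq_ob A B F G z)
        [(x, f, y), (y, g, z)] [(x, Comp B x y z g f, z)]"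
| path_append:
    "\<lbrakk>coeq_path_eq A B F G c d p p'; coeq_path_eq A B F G d e q q'\<rbrakk> \<Longrightarrow>
      coeq_path_eq A B F G c e (p @ q) (p' @ q')"
| path_refl: "coeq_path A B F G c d p \<Longrightarrow> coeq_path_eq A B F G c d p p"
| path_sym: "coeq_path_eq A B F G c d p q \<Longrightarrow> coeq_path_eq A B F G c d q p"
| path_trans:
    "\<lbrakk>coeq_path_eq A B F G c d p q; coeq_path_eq A B F G c d q r\<rbrakk> \<Longrightarrow>
      coeq_path_eq A B F G c d p r"

definition coeq_mor ::
    "('o, 'm) cat \<Rightarrow> ('p, 'n) cat \<Rightarrow> ('o, 'm, 'p, 'n) func \<Rightarrow> ('o, 'm, 'p, 'n) func \<Rightarrow>
     'p set \<Rightarrow> 'p set \<Rightarrow> ('p \<times> 'n \<times> 'p) list \<Rightarrow> ('p \<times> 'n \<times> 'p) list set" where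
  "coeq_mor A B F G c d p = {q. coeq_path_eq A B F G c d p q}"

definition coeq_cat ::
    "('o, 'm) cat \<Rightarrow> ('p, 'n) cat \<Rightarrow> ('o, 'm, 'p, 'n) func \<Rightarrow> ('o, 'm, 'p, 'n) func \<Rightarrow>
     ('p set, ('p \<times> 'n \<times> 'p) list set) cat" where
  "coeq_cat A B F G =
    \<lparr>Ob = coeq_ob A B F G ` Ob B,
     Mor = (\<lambda>c d. coeq_mor A B F G c d ` {p. coeq_path A B F G c d p}),
     Ident = (\<lambda>c. coeq_mor A B F G c c []),
     Comp = (\<lambda>c d e Q P. \<Union>p\<in>P. \<Union>q\<in>Q. coeq_mor A B F G c e (p @ q))\<rparr>"

definition coeq_proj ::
    "('o, 'm) cat \<Rightarrow> ('p, 'n) cat \<Rightarrow> ('o, 'm, 'p, 'n) func \<Rightarrow> ('o, 'm, 'p, 'n) func \<Rightarrow>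
     ('p, 'n, 'p set, ('p \<times> 'n \<times> 'p) list set) func" where
  "coeq_proj A B F G =
    \<lparr>omap = coeq_ob A B F G,
     mmap = (\<lambda>x y f. coeq_mor A B F G (coeq_ob A B F G x) (coeq_ob A B F G y) [(x, f, y)])\<rparr>"

locale parallel_functors = F: cat_functor A B F + G: cat_functor A B G
  for A :: "('o, 'm) cat" and B :: "('p, 'n) cat" and F G
begin

abbreviation "ob \<equiv> coeq_ob A B F G"
abbreviation "ob_eq \<equiv> coeq_ob_eq A B F G"
abbreviation "path \<equiv> coeq_path A B F G"
abbreviation "path_eq \<equiv> coeq_path_eq A B F G"
abbreviation "mor \<equiv> coeq_mor A B F G"
abbreviation "Q \<equiv> coeq_cat A B F G"
abbreviation "proj \<equiv> coeq_proj A B F G"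

lemma ob_eq_Ob: "ob_eq x y \<Longrightarrow> x \<in> Ob B \<and> y \<in> Ob B"
  by (induction rule: coeq_ob_eq.induct) (auto simp: F.omap_closed G.omap_closed)

lemma ob_eqD: "ob_eq x y \<Longrightarrow> ob x = ob y"
  unfolding coeq_ob_def by (auto intro: ob_sym ob_trans)

lemma ob_eqI: "\<lbrakk>x \<in> Ob B; ob x = ob y\<rbrakk> \<Longrightarrow> ob_eq x y"
  unfolding coeq_ob_def by (metis ob_refl ob_sym mem_Collect_eq)

lemma ob_F_G: "a \<in> Ob A \<Longrightarrow> ob (omap F a) = ob (omap G a)"
  by (intro ob_eqD ob_gen)

lemma path_Ob: "path c d p \<Longrightarrow> c \<in> ob ` Ob B \<and> d \<in> ob ` Ob B"
  by (induction rule: coeq_path.induct) auto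

lemma path_singleton: "\<lbrakk>x \<in> Ob B; y \<in> Ob B; f \<in> Mor B x y\<rbrakk> \<Longrightarrow> path (ob x) (ob y) [(x, f, y)]"
  by (intro path_Cons path_Nil)

lemma path_comp: "\<lbrakk>path c d p; path d e q\<rbrakk> \<Longrightarrow> path c e (p @ q)"
  by (induction rule: coeq_path.induct) (auto intro: path_Cons)

lemma path_eq_path: "path_eq c d p q \<Longrightarrow> path c d p \<and> path c d q"
proof (induction rule: coeq_path_eq.induct)
  case (path_gen a b h)
  then have "path (ob (omap G a)) (ob (omap G b)) [(omap G a, mmap G a b h, omap G b)]"
    by (intro path_singleton G.omap_closed G.mmap_closed)
  moreover from path_gen
  have "path (ob (omap F a)) (ob (omap F b)) [(omap F a, mmap F a b h, omap F b)]"
    by (intro path_singleton F.omap_closed F.mmap_closed)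
  ultimately show ?case using path_gen by (simp add: ob_F_G)
next
  case (path_Ident x)
  then show ?case by (auto intro!: path_singleton path_Nil F.D.Ident_closed)
next
  case (path_Comp x y z f g)
  then show ?case by (auto intro!: path_Cons path_Nil F.D.Comp_closed)
next
  case (path_append c d p p' e q q')
  then show ?case by (auto intro: path_comp)
qed auto

lemma mor_eqD: "path_eq c d p q \<Longrightarrow> mor c d p = mor c d q"
  unfolding coeq_mor_def by (auto intro: path_sym path_trans)

lemma mor_eqI: "\<lbrakk>path c d p; mor c d p = mor c d q\<rbrakk> \<Longrightarrow> path_eq c d p q"
  unfolding coeq_mor_def by (metis path_refl path_sym mem_Collect_eq)

lemma Ob_Q: "Ob Q = ob ` Ob B"
  by (simp add: coeq_cat_def)

lemma mor_in_Q: "path c d p \<Longrightarrow> mor c d p \<in> Mor Q c d"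
  by (simp add: coeq_cat_def)

lemma Comp_mor:
  assumes "path c d p" "path d e q"
  shows "Comp Q c d e (mor d e q) (mor c d p) = mor c e (p @ q)"
proof -
  have "(\<Union>p'\<in>mor c d p. \<Union>q'\<in>mor d e q. mor c e (p' @ q')) =
      (\<Union>p'\<in>mor c d p. \<Union>q'\<in>mor d e q. mor c e (p @ q))"
    by (intro SUP_cong refl mor_eqD) (auto simp: coeq_mor_def intro: path_sym path_append)
  moreover have "p \<in> mor c d p" "q \<in> mor d e q"
    using assms by (simp_all add: coeq_mor_def path_refl)
  then have "mor c d p \<noteq> {}" "mor d e q \<noteq> {}" by blast+
  ultimately show ?thesis by (simp add: coeq_cat_def)
qed

lemma coeq_category: "category Q"
proof
  fix x assume "x \<in> Ob Q"
  then show "Ident Q x \<in> Mor Q x x" by (auto simp: coeq_cat_def intro: path_Nil)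
next
  fix x y z f g assume "f \<in> Mor Q x y" "g \<in> Mor Q y z"
  then obtain p q where "path x y p" "f = mor x y p" "path y z q" "g = mor y z q"
    by (auto simp: coeq_cat_def)
  then show "Comp Q x y z g f \<in> Mor Q x z"
    by (simp add: Comp_mor) (auto simp: coeq_cat_def path_comp)
next
  fix x y f assume "x \<in> Ob Q" "y \<in> Ob Q" "f \<in> Mor Q x y"
  then obtain p where p: "path x y p" "f = mor x y p" "path x x []" "path y y []"
    by (auto simp: coeq_cat_def intro: path_Nil)
  moreover have "Ident Q x = mor x x []" "Ident Q y = mor y y []"
    by (auto simp: coeq_cat_def)
  ultimately show "Comp Q x y y (Ident Q y) f = f" "Comp Q x x y f (Ident Q x) = f"
    by (simp_all add: Comp_mor)
next
  fix w x y z f g h assume "f \<in> Mor Q w x" "g \<in> Mor Q x y" "h \<in> Mor Q y z"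
  then obtain p q r where "path w x p" "f = mor w x p" "path x y q" "g = mor x y q"
      "path y z r" "h = mor y z r"
    by (auto simp: coeq_cat_def)
  then show "Comp Q w x z (Comp Q x y z h g) f = Comp Q w y z h (Comp Q w x y g f)"
    by (simp add: Comp_mor path_comp)
qed

lemma proj_functor: "cat_functor B Q proj"
proof (intro cat_functor.intro cat_functor_axioms.intro coeq_category F.D.category_axioms)
  fix x assume "x \<in> Ob B"
  then show "omap proj x \<in> Ob Q" by (auto simp: coeq_proj_def coeq_cat_def)
next
  fix x y f assume "x \<in> Ob B" "y \<in> Ob B" "f \<in> Mor B x y"
  then show "mmap proj x y f \<in> Mor Q (omap proj x) (omap proj y)"
    by (auto simp: coeq_proj_def coeq_cat_def intro: path_singleton)
next
  fix x assume "x \<in> Ob B"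
  then show "mmap proj x x (Ident B x) = Ident Q (omap proj x)"
    using mor_eqD[OF path_Ident] by (simp add: coeq_proj_def coeq_cat_def)
next
  fix x y z f g assume *: "x \<in> Ob B" "y \<in> Ob B" "z \<in> Ob B" "f \<in> Mor B x y" "g \<in> Mor B y z"
  have "mor (ob x) (ob z) [(x, Comp B x y z g f, z)] = mor (ob x) (ob z) [(x, f, y), (y, g, z)]"
    using * by (intro mor_eqD path_sym[OF path_Comp])
  then show "mmap proj x z (Comp B x y z g f) =
      Comp Q (omap proj x) (omap proj y) (omap proj z) (mmap proj y z g) (mmap proj x y f)"
    using * Comp_mor[OF path_singleton path_singleton, of x y f z g]
    by (simp add: coeq_proj_def)
qed

lemma proj_coequalizes: "func_eq A (func_comp proj F) (func_comp proj G)"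
  unfolding func_eq_def func_comp_def coeq_proj_def
  using mor_eqD[OF path_gen] by (auto simp: ob_F_G[symmetric])

theorem coeq_universal:
  fixes D :: "('q, 'l) cat"
  assumes H: "cat_functor B D H" and HFG: "func_eq A (func_comp H F) (func_comp H G)"
  obtains K where "cat_functor Q D K" "func_eq B (func_comp K proj) H"
    "\<And>K'. \<lbrakk>cat_functor Q D K'; func_eq B (func_comp K' proj) H\<rbrakk> \<Longrightarrow> func_eq Q K' K"
proof -
  interpret H: cat_functor B D H by fact
  define kob where "kob c = omap H (SOME x. x \<in> Ob B \<and> c = ob x)" for c
  have H_eq: "omap H x = omap H y" if "ob_eq x y" for x y
    using that HFG
    by (induction rule: coeq_ob_eq.induct) (auto simp: func_eq_def func_comp_def)
  have kob: "kob (ob x) = omap H x" if "x \<in> Ob B" for x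
  proof -
    have "(SOME y. y \<in> Ob B \<and> ob x = ob y) \<in> Ob B \<and> ob x = ob (SOME y. y \<in> Ob B \<and> ob x = ob y)"
      by (rule someI[of _ x]) (use that in auto)
    then show ?thesis unfolding kob_def using ob_eqI[OF that] H_eq by metis
  qed
  define ev where "ev d p = foldr (\<lambda>(x, f, y) r. Comp D (omap H x) (omap H y) (kob d) r (mmap H x y f))
      p (Ident D (kob d))" for d p
  have ev_simps: "ev d [] = Ident D (kob d)"
    "ev d ((x, f, y) # p) = Comp D (omap H x) (omap H y) (kob d) (ev d p) (mmap H x y f)"
    for d x f y p by (auto simp: ev_def)
  have kob_Ob: "kob c \<in> Ob D" if "c \<in> ob ` Ob B" for c
    using that by (auto simp: kob H.omap_closed)
  have ev_closed: "ev d p \<in> Mor D (kob c) (kob d)" if "path c d p" for c d p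
    using that
  proof (induction rule: coeq_path.induct)
    case (path_Nil x)
    then show ?case by (auto simp: ev_simps kob H.omap_closed H.D.Ident_closed)
  next
    case (path_Cons x y f d p)
    then show ?case using path_Ob[OF path_Cons.hyps(4)]
      by (auto simp: ev_simps kob intro!: H.D.Comp_closed H.omap_closed H.mmap_closed)
  qed
  have ev_append: "ev e (p @ q) = Comp D (kob c) (kob d) (kob e) (ev e q) (ev d p)"
    if "path c d p" "path d e q" for c d e p q
    using that
  proof (induction rule: coeq_path.induct)
    case (path_Nil x)
    then show ?case using ev_closed[OF path_Nil(2)] path_Ob[OF path_Nil(2)]
      by (simp add: ev_simps H.D.Comp_Ident_right kob_Ob)
  next
    case (path_Cons x y f d p)
    then show ?case using ev_closed[OF path_Cons.hyps(4)] ev_closed[OF path_Cons.prems]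
        path_Ob[OF path_Cons.prems] H.mmap_closed[OF path_Cons.hyps(1-3)]
      by (simp add: ev_simps kob) (rule H.D.Comp_assoc;
          simp add: kob_Ob H.omap_closed)
  qed
  have ev_single: "ev (ob y) [(x, f, y)] = mmap H x y f"
    if "x \<in> Ob B" "y \<in> Ob B" "f \<in> Mor B x y" for x y f
    using that by (simp add: ev_simps kob H.D.Comp_Ident_left H.omap_closed H.mmap_closed)
  have ev_eq: "ev d p = ev d q" if "path_eq c d p q" for c d p q
    using that
  proof (induction rule: coeq_path_eq.induct)
    case (path_gen a b h)
    have "ev (ob (omap F b)) [(omap F a, mmap F a b h, omap F b)] =
        mmap H (omap F a) (omap F b) (mmap F a b h)"
      using path_gen by (intro ev_single F.omap_closed F.mmap_closed)
    moreover have "ev (ob (omap G b)) [(omap G a, mmap G a b h, omap G b)] =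
        mmap H (omap G a) (omap G b) (mmap G a b h)"
      using path_gen by (intro ev_single G.omap_closed G.mmap_closed)
    ultimately show ?case
      using path_gen HFG by (simp add: func_eq_def func_comp_def ob_F_G)
  next
    case (path_Ident x)
    then show ?case
      by (simp add: ev_single F.D.Ident_closed H.mmap_Ident) (simp add: ev_simps kob)
  next
    case (path_Comp x y z f g)
    then show ?case
      by (simp add: ev_single F.D.Comp_closed H.mmap_Comp)
         (simp add: ev_simps kob H.D.Comp_Ident_left H.omap_closed H.mmap_closed)
  next
    case (path_append c d p p' e q q')
    then show ?case
      using ev_append[of c d p e q] ev_append[of c d p' e q']
        path_eq_path[OF path_append.hyps(1)] path_eq_path[OF path_append.hyps(2)]
      by simp
  qed auto
  define K where "K = \<lparr>omap = kob, mmap = (\<lambda>c d P. ev d (SOME p. p \<in> P))\<rparr>"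
  have K_mor: "mmap K c d (mor c d p) = ev d p" if "path c d p" for c d p
  proof -
    have "(SOME q. q \<in> mor c d p) \<in> mor c d p"
      by (rule someI[of _ p]) (use that in \<open>auto simp: coeq_mor_def intro: path_refl\<close>)
    then show ?thesis unfolding K_def using ev_eq by (auto simp: coeq_mor_def)
  qed
  have K_omap: "omap K = kob" by (simp add: K_def)
  have 1: "cat_functor Q D K"
  proof (intro cat_functor.intro cat_functor_axioms.intro coeq_category H.D.category_axioms)
    fix c assume c: "c \<in> Ob Q"
    then show "omap K c \<in> Ob D" by (simp add: K_omap kob_Ob coeq_cat_def)
    have "path c c []" using c by (auto simp: coeq_cat_def intro: path_Nil)
    then show "mmap K c c (Ident Q c) = Ident D (omap K c)"
      using K_mor[of c c "[]"] by (simp add: coeq_cat_def K_omap ev_simps)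
  next
    fix c d f assume "f \<in> Mor Q c d"
    then obtain p where "path c d p" "f = mor c d p" by (auto simp: coeq_cat_def)
    then show "mmap K c d f \<in> Mor D (omap K c) (omap K d)"
      by (simp add: K_mor K_omap ev_closed)
  next
    fix x y z f g assume "f \<in> Mor Q x y" "g \<in> Mor Q y z"
    then obtain p q where "path x y p" "f = mor x y p" "path y z q" "g = mor y z q"
      by (auto simp: coeq_cat_def)
    then show "mmap K x z (Comp Q x y z g f) =
        Comp D (omap K x) (omap K y) (omap K z) (mmap K y z g) (mmap K x y f)"
      by (simp add: Comp_mor K_mor path_comp K_omap ev_append)
  qed
  have 2: "func_eq B (func_comp K proj) H"
    by (simp add: func_eq_def func_comp_def coeq_proj_def K_omap kob K_mor path_singleton ev_single)
  have 3: "func_eq Q K' K"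
    if "cat_functor Q D K'" and K'H: "func_eq B (func_comp K' proj) H" for K'
  proof -
    interpret K': cat_functor Q D K' by fact
    have ob': "omap K' (ob x) = omap H x" if "x \<in> Ob B" for x
      using K'H that by (simp add: func_eq_def func_comp_def coeq_proj_def)
    have mor': "mmap K' (ob x) (ob y) (mor (ob x) (ob y) [(x, f, y)]) = mmap H x y f"
      if "x \<in> Ob B" "y \<in> Ob B" "f \<in> Mor B x y" for x y f
      using K'H that by (simp add: func_eq_def func_comp_def coeq_proj_def)
    have ob'': "omap K' c = kob c" if "c \<in> ob ` Ob B" for c
      using that by (auto simp: ob' kob)
    have "mmap K' c d (mor c d p) = ev d p" if "path c d p" for c d p
      using that
    proof (induction rule: coeq_path.induct)
      case (path_Nil x)
      then show ?case using K'.mmap_Ident[of "ob x"]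
        by (simp add: coeq_cat_def ev_simps kob ob')
    next
      case (path_Cons x y f d p)
      note s = path_singleton[OF path_Cons.hyps(1-3)]
      have *: "mor (ob x) d ((x, f, y) # p) =
          Comp Q (ob x) (ob y) d (mor (ob y) d p) (mor (ob x) (ob y) [(x, f, y)])"
        using Comp_mor[OF s path_Cons.hyps(4)] by simp
      have "mmap K' (ob x) d (mor (ob x) d ((x, f, y) # p)) =
          Comp D (omap K' (ob x)) (omap K' (ob y)) (omap K' d)
            (mmap K' (ob y) d (mor (ob y) d p))
            (mmap K' (ob x) (ob y) (mor (ob x) (ob y) [(x, f, y)]))"
        unfolding * using path_Ob[OF path_Cons.hyps(4)] path_Ob[OF s]
        by (intro K'.mmap_Comp mor_in_Q s path_Cons.hyps(4)) (simp_all add: Ob_Q)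
      then show ?case
        using path_Cons path_Ob[OF path_Cons.hyps(4)] by (simp add: ev_simps mor' ob'' kob)
    qed
    then have "mmap K' c d f = mmap K c d f" if "f \<in> Mor Q c d" for c d f
      using that K_mor by (auto simp: coeq_cat_def)
    then show ?thesis
      using ob'' by (simp add: func_eq_def K_omap Ob_Q)
  qed
  from 1 2 3 show ?thesis by (rule that)
qed

end


section \<open>The free \<open>\<Lambda>\<close>-monoidal category\<close>

definition E_cat :: "(nat \<Rightarrow> 'a monoid) \<Rightarrow> nat \<Rightarrow> ('a, unit) cat" where
  "E_cat \<Lambda> n = indiscrete_cat (carrier (\<Lambda> n))"

definition act_source ::
    "(nat \<Rightarrow> 'a monoid) \<Rightarrow> ('o, 'm) cat \<Rightarrow> nat \<Rightarrow>
     ('a \<times> 'a \<times> 'o list, unit \<times> unit \<times> 'm list) cat" where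
  "act_source \<Lambda> X n =
    prod_cat (E_cat \<Lambda> n) (prod_cat (discrete_cat (carrier (\<Lambda> n))) (power_cat n X))"

definition act_target ::
    "(nat \<Rightarrow> 'a monoid) \<Rightarrow> ('o, 'm) cat \<Rightarrow> nat \<Rightarrow> ('a \<times> 'o list, unit \<times> 'm list) cat" where
  "act_target \<Lambda> X n = prod_cat (E_cat \<Lambda> n) (power_cat n X)"

definition right_act ::
    "(nat \<Rightarrow> 'a monoid) \<Rightarrow> nat \<Rightarrow>
     ('a \<times> 'a \<times> 'o list, unit \<times> unit \<times> 'm list, 'a \<times> 'o list, unit \<times> 'm list) func" where
  "right_act \<Lambda> n =
    \<lparr>omap = (\<lambda>(p, g, xs). (p \<otimes>\<^bsub>\<Lambda> n\<^esub> g, xs)),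
     mmap = (\<lambda>_ _ (_, _, fs). ((), fs))\<rparr>"

text \<open>On morphisms, \<open>g\<close> is read off from the source \<open>(p, g, xs)\<close>; it agrees with that of the target,
  the middle factor being discrete.\<close>

definition left_act ::
    "(nat \<Rightarrow> 'a \<Rightarrow> nat \<Rightarrow> nat) \<Rightarrow> nat \<Rightarrow>
     ('a \<times> 'a \<times> 'o list, unit \<times> unit \<times> 'm list, 'a \<times> 'o list, unit \<times> 'm list) func" where
  "left_act \<pi> n =
    \<lparr>omap = (\<lambda>(p, g, xs). (p, perm_tuple (\<pi> n g) xs)),
     mmap = (\<lambda>(_, g, _) _ (_, _, fs). ((), perm_tuple (\<pi> n g) fs))\<rparr>"

definition E_tensor ::
    "(nat \<Rightarrow> 'a monoid) \<Rightarrow> (nat \<Rightarrow> 'a \<Rightarrow> nat \<Rightarrow> nat) \<Rightarrow> ('o, 'm) cat \<Rightarrow> nat \<Rightarrow>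
     (('a \<times> 'o list) set,
      (('a \<times> 'o list) \<times> (unit \<times> 'm list) \<times> ('a \<times> 'o list)) list set) cat" where
  "E_tensor \<Lambda> \<pi> X n =
    coeq_cat (act_source \<Lambda> X n) (act_target \<Lambda> X n) (right_act \<Lambda> n) (left_act \<pi> n)"

definition free_cat ::
    "(nat \<Rightarrow> 'a monoid) \<Rightarrow> (nat \<Rightarrow> 'a \<Rightarrow> nat \<Rightarrow> nat) \<Rightarrow> ('o, 'm) cat \<Rightarrow>
     (nat \<times> ('a \<times> 'o list) set,
      (('a \<times> 'o list) \<times> (unit \<times> 'm list) \<times> ('a \<times> 'o list)) list set) cat" where
  "free_cat \<Lambda> \<pi> X = coprod_cat (E_tensor \<Lambda> \<pi> X)"

end

theory Submission
  imports Defs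
begin

text \<open>
  In the coequalizer, $(p,\underline x)$ is identified with $(e,p\cdot\underline x)$, so every object
  has a unique representative with first component $e$, i.e. a tuple. A morphism
  $(p,\underline x)\to(q,\underline y)$ given by $f_i\colon x_i\to y_i$ becomes the element
  $g=qp^{-1}$ together with the permuted tuple $p\cdot\underline f$; conversely $(g,\underline f)$ is
  represented by $\underline f\colon(e,\underline x)\to(g,g^{-1}\cdot\underline y)$. One
  round trip is a direct computation, the other follows from the uniqueness clause of the universal
  property, which spares any analysis of paths beyond the compatibility with composition.
\<close>


section \<open>Permuting tuples\<close>

lemma length_perm_tuple [simp]: "length (perm_tuple p xs) = length xs"
  by (simp add: perm_tuple_def)

lemma nth_perm_tuple: "i < length xs \<Longrightarrow> perm_tuple p xs ! i = xs ! inv_into UNIV p i"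
  by (simp add: perm_tuple_def)

lemma permutes_less: "\<lbrakk>p permutes {..<n}; i < n\<rbrakk> \<Longrightarrow> p i < n" for n :: nat
  using permutes_in_image[of p "{..<n}" i] by simp

lemma inv_permutes_less: "\<lbrakk>p permutes {..<n}; i < n\<rbrakk> \<Longrightarrow> inv_into UNIV p i < n" for n :: nat
  by (rule permutes_less[OF permutes_inv])

lemma perm_tuple_id: "perm_tuple id xs = xs"
  by (rule nth_equalityI) (simp_all add: nth_perm_tuple)

text \<open>Entry \<open>i\<close> of either side is entry \<open>q^-1 (p^-1 i)\<close> of
  \<open>xs\<close>. The inverse in \<open>perm_tuple\<close> is what makes this a left
  action.\<close>

lemma perm_tuple_comp:
  assumes "p permutes {..<length xs}" "q permutes {..<length xs}"
  shows "perm_tuple p (perm_tuple q xs) = perm_tuple (p \<circ> q) xs"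
proof (rule nth_equalityI)
  fix i assume "i < length (perm_tuple p (perm_tuple q xs))"
  then show "perm_tuple p (perm_tuple q xs) ! i = perm_tuple (p \<circ> q) xs ! i"
    using assms by (simp add: nth_perm_tuple inv_permutes_less o_inv_distrib permutes_bij)
qed simp

lemma perm_tuple_map:
  "p permutes {..<length xs} \<Longrightarrow> perm_tuple p (map f xs) = map f (perm_tuple p xs)"
  by (auto simp: perm_tuple_def inv_permutes_less)

lemma set_perm_tuple_subset: "p permutes {..<length xs} \<Longrightarrow> set (perm_tuple p xs) \<subseteq> set xs"
  by (auto simp: perm_tuple_def inv_permutes_less)


section \<open>Categories and their isomorphisms\<close>

lemma category_indiscrete_cat: "category (indiscrete_cat A)"
  by unfold_locales (simp_all add: indiscrete_cat_def)

lemma category_discrete_cat: "category (discrete_cat A)"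
  by unfold_locales (auto simp: discrete_cat_def split: if_splits)

lemma category_prod_cat:
  assumes "category C" "category D"
  shows "category (prod_cat C D)"
proof -
  interpret C: category C by fact
  interpret D: category D by fact
  show ?thesis
    by unfold_locales
      (auto simp: prod_cat_def C.Ident_closed D.Ident_closed C.Comp_closed D.Comp_closed
        C.Comp_Ident_left D.Comp_Ident_left C.Comp_Ident_right D.Comp_Ident_right
        intro: C.Comp_assoc D.Comp_assoc)
qed

lemma category_power_cat:
  assumes "category C"
  shows "category (power_cat n C)"
proof -
  interpret category C by fact
  show ?thesis
    by unfold_locales
      (auto simp: power_cat_def subset_eq all_set_conv_all_nth Ident_closed Comp_closed
        Comp_Ident_left Comp_Ident_right list_eq_iff_nth_eq intro: Comp_assoc)
qed

lemma category_coprod_cat: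
  assumes "\<And>i. category (C i)"
  shows "category (coprod_cat C)"
proof -
  interpret category "C i" for i by fact
  show ?thesis
    by unfold_locales
      (auto simp: coprod_cat_def Ident_closed Comp_closed Comp_Ident_left Comp_Ident_right
        split: if_splits intro: Comp_assoc)
qed

text \<open>The axioms quantify over objects only, so replacing the field \<open>Ob\<close> alone
  yields the full subcategory. The tuples of a fixed length will be treated this way.\<close>

lemma category_full_subcat:
  assumes "category C" "S \<subseteq> Ob C"
  shows "category (C\<lparr>Ob := S\<rparr>)"
proof -
  interpret category C by fact
  show ?thesis
    by unfold_locales
      (use assms(2) in \<open>auto simp: subset_iff Ident_closed Comp_closed Comp_Ident_left
        Comp_Ident_right intro: Comp_assoc\<close>)
qed

lemma cat_functor_comp:
  assumes "cat_functor C D F" "cat_functor D E G"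
  shows "cat_functor C E (func_comp G F)"
proof -
  interpret F: cat_functor C D F by fact
  interpret G: cat_functor D E G by fact
  show ?thesis
    by unfold_locales
      (simp_all add: func_comp_def F.omap_closed G.omap_closed F.mmap_closed G.mmap_closed
        F.mmap_Ident G.mmap_Ident F.mmap_Comp G.mmap_Comp)
qed

lemma cat_functor_id: "category C \<Longrightarrow> cat_functor C C func_id"
  by (simp add: cat_functor_def cat_functor_axioms_def func_id_def)

lemma cat_isomorphic_trans:
  assumes "cat_isomorphic C D" "cat_isomorphic D E"
  shows "cat_isomorphic C E"
proof -
  obtain F G where FG: "cat_functor C D F" "cat_functor D C G"
      "func_eq C (func_comp G F) func_id" "func_eq D (func_comp F G) func_id"
    using assms(1) by (auto simp: cat_isomorphic_def)
  obtain H K where HK: "cat_functor D E H" "cat_functor E D K"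
      "func_eq D (func_comp K H) func_id" "func_eq E (func_comp H K) func_id"
    using assms(2) by (auto simp: cat_isomorphic_def)
  interpret F: cat_functor C D F by fact
  interpret K: cat_functor E D K by fact
  have "func_eq C (func_comp (func_comp G K) (func_comp H F)) func_id"
    using FG(3) HK(3)
    by (simp add: func_eq_def func_comp_def func_id_def F.omap_closed F.mmap_closed)
  moreover have "func_eq E (func_comp (func_comp H F) (func_comp G K)) func_id"
    using FG(4) HK(4)
    by (simp add: func_eq_def func_comp_def func_id_def K.omap_closed K.mmap_closed)
  ultimately show ?thesis
    using cat_functor_comp[OF FG(1) HK(1)] cat_functor_comp[OF HK(2) FG(2)]
    by (auto simp: cat_isomorphic_def)
qed

section \<open>Coproducts of categories and splitting by degree\<close>

text \<open>Between different indices there are no morphisms, so using the index of the source in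
  \<open>mmap\<close> is a harmless default there.\<close>

definition coprod_func :: "('i \<Rightarrow> ('o, 'm, 'p, 'n) func) \<Rightarrow> ('i \<times> 'o, 'm, 'i \<times> 'p, 'n) func" where
  "coprod_func F =
    \<lparr>omap = (\<lambda>(i, x). (i, omap (F i) x)), mmap = (\<lambda>(i, x) (j, y). mmap (F i) x y)\<rparr>"

lemma cat_functor_coprod:
  assumes "\<And>i. cat_functor (C i) (D i) (F i)"
  shows "cat_functor (coprod_cat C) (coprod_cat D) (coprod_func F)"
proof -
  interpret F: cat_functor "C i" "D i" "F i" for i by fact
  interpret C: category "coprod_cat C" by (intro category_coprod_cat F.C.category_axioms)
  interpret D: category "coprod_cat D" by (intro category_coprod_cat F.D.category_axioms)
  show ?thesis
    by unfold_locales
      (auto simp: coprod_cat_def coprod_func_def F.omap_closed F.mmap_closed F.mmap_Ident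
        F.mmap_Comp split: if_splits)
qed

lemma cat_isomorphic_coprod:
  assumes "\<And>i. cat_isomorphic (C i) (D i)"
  shows "cat_isomorphic (coprod_cat C) (coprod_cat D)"
proof -
  obtain F G where FG: "\<And>i. cat_functor (C i) (D i) (F i)" "\<And>i. cat_functor (D i) (C i) (G i)"
      "\<And>i. func_eq (C i) (func_comp (G i) (F i)) func_id"
      "\<And>i. func_eq (D i) (func_comp (F i) (G i)) func_id"
    using assms unfolding cat_isomorphic_def by metis
  have "func_eq (coprod_cat C) (func_comp (coprod_func G) (coprod_func F)) func_id"
    "func_eq (coprod_cat D) (func_comp (coprod_func F) (coprod_func G)) func_id"
    using FG(3,4)
    by (auto simp: func_eq_def func_comp_def func_id_def coprod_func_def coprod_cat_def
        split: if_splits)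
  then show ?thesis
    using cat_functor_coprod[of C D F, OF FG(1)] cat_functor_coprod[of D C G, OF FG(2)]
    by (auto simp: cat_isomorphic_def)
qed

text \<open>Morphisms preserve the degree, so no hom-set is lost when \<open>C\<close> is cut into
  its full subcategories of constant degree. With the length as degree, this turns the coproduct
  over arities into one category of tuples of all lengths.\<close>

lemma coprod_graded_isomorphic:
  fixes deg :: "'o \<Rightarrow> 'i"
  assumes "category C"
    and deg: "\<And>x y f. \<lbrakk>x \<in> Ob C; y \<in> Ob C; f \<in> Mor C x y\<rbrakk> \<Longrightarrow> deg x = deg y"
  shows "cat_isomorphic (coprod_cat (\<lambda>i. C\<lparr>Ob := {x \<in> Ob C. deg x = i}\<rparr>)) C"
proof -
  interpret C: category C by fact
  let ?P = "coprod_cat (\<lambda>i. C\<lparr>Ob := {x \<in> Ob C. deg x = i}\<rparr>)"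
  interpret P: category ?P
    by (intro category_coprod_cat category_full_subcat assms(1)) auto
  let ?F = "\<lparr>omap = snd, mmap = (\<lambda>(i, x) (j, y) f. f)\<rparr>
    :: ('i \<times> 'o, 'm, 'o, 'm) func"
  let ?G = "\<lparr>omap = (\<lambda>x. (deg x, x)), mmap = (\<lambda>x y f. f)\<rparr>
    :: ('o, 'm, 'i \<times> 'o, 'm) func"
  have "cat_functor ?P C ?F"
    by unfold_locales (auto simp: coprod_cat_def split: if_splits)
  moreover have "cat_functor C ?P ?G"
    by unfold_locales (auto simp: coprod_cat_def dest: deg)
  moreover have "func_eq ?P (func_comp ?G ?F) func_id" "func_eq C (func_comp ?F ?G) func_id"
    by (auto simp: func_eq_def func_comp_def func_id_def coprod_cat_def)
  ultimately show ?thesis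
    unfolding cat_isomorphic_def by blast
qed


section \<open>The explicit model\<close>

text \<open>The composition is that of a wreath product: component \<open>i\<close> of the first
  morphism ends at position \<open>\<pi> n g i\<close> and is continued by the component of the
  second morphism at that position. For symmetric groups and a one-object groupoid \<open>X\<close>,
  the endomorphisms of a tuple form the usual wreath product.\<close>

definition wreath_cat ::
    "(nat \<Rightarrow> 'a monoid) \<Rightarrow> (nat \<Rightarrow> 'a \<Rightarrow> nat \<Rightarrow> nat) \<Rightarrow> ('o, 'm) cat \<Rightarrow>
     ('o list, 'a \<times> 'm list) cat" where
  "wreath_cat \<Lambda> \<pi> X =
    \<lparr>Ob = lists (Ob X),
     Mor = (\<lambda>xs ys. if length xs \<noteq> length ys then {}
       else SIGMA g:carrier (\<Lambda> (length xs)).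
         {fs. length fs = length xs \<and>
           (\<forall>i<length xs. fs ! i \<in> Mor X (xs ! i) (ys ! \<pi> (length xs) g i))}),
     Ident = (\<lambda>xs. (\<one>\<^bsub>\<Lambda> (length xs)\<^esub>, map (Ident X) xs)),
     Comp = (\<lambda>xs ys zs (h, gs) (g, fs). let n = length xs in
       (h \<otimes>\<^bsub>\<Lambda> n\<^esub> g,
        map (\<lambda>i. Comp X (xs ! i) (ys ! \<pi> n g i) (zs ! \<pi> n h (\<pi> n g i)) (gs ! \<pi> n g i) (fs ! i))
          [0..<n]))\<rparr>"

text \<open>These are the data from which the tensor products over the groups are built: the groups
  themselves and their homomorphisms to the symmetric groups.\<close>

locale groups_over_perms = X: category X
  for \<Lambda> :: "nat \<Rightarrow> 'a monoid" and \<pi> :: "nat \<Rightarrow> 'a \<Rightarrow> nat \<Rightarrow> nat" and X :: "('o, 'm) cat" +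
  assumes group: "group (\<Lambda> n)"
    and \<pi>_hom: "\<pi> n \<in> hom (\<Lambda> n) (perm_group n)"
begin

sublocale group "\<Lambda> n" for n by (rule group)

lemma \<pi>_permutes: "g \<in> carrier (\<Lambda> n) \<Longrightarrow> \<pi> n g permutes {..<n}"
  using hom_in_carrier[OF \<pi>_hom] by (simp add: perm_group_def)

lemma \<pi>_mult: "\<lbrakk>g \<in> carrier (\<Lambda> n); h \<in> carrier (\<Lambda> n)\<rbrakk> \<Longrightarrow> \<pi> n (g \<otimes>\<^bsub>\<Lambda> n\<^esub> h) = \<pi> n g \<circ> \<pi> n h"
  using hom_mult[OF \<pi>_hom] by (simp add: perm_group_def)

lemma \<pi>_less: "\<lbrakk>g \<in> carrier (\<Lambda> n); i < n\<rbrakk> \<Longrightarrow> \<pi> n g i < n"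
  by (rule permutes_less[OF \<pi>_permutes])

text \<open>The image of the unit is an idempotent permutation; cancelling one factor leaves the
  identity.\<close>

lemma \<pi>_one: "\<pi> n \<one>\<^bsub>\<Lambda> n\<^esub> = id"
proof -
  have "\<pi> n \<one>\<^bsub>\<Lambda> n\<^esub> \<circ> \<pi> n \<one>\<^bsub>\<Lambda> n\<^esub> = \<pi> n \<one>\<^bsub>\<Lambda> n\<^esub>"
    using \<pi>_mult[of "\<one>\<^bsub>\<Lambda> n\<^esub>" n "\<one>\<^bsub>\<Lambda> n\<^esub>"] by simp
  then show ?thesis
    using permutes_inv_o(2)[OF \<pi>_permutes[OF one_closed]] by (metis comp_assoc comp_id id_comp)
qed

section \<open>The group action on tuples\<close>

abbreviation act :: "nat \<Rightarrow> 'a \<Rightarrow> 'b list \<Rightarrow> 'b list" where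
  "act n g xs \<equiv> perm_tuple (\<pi> n g) xs"

lemma act_one: "act n \<one>\<^bsub>\<Lambda> n\<^esub> xs = xs"
  by (simp add: \<pi>_one perm_tuple_id)

lemma act_mult:
  "\<lbrakk>g \<in> carrier (\<Lambda> n); h \<in> carrier (\<Lambda> n); length xs = n\<rbrakk> \<Longrightarrow>
    act n (g \<otimes>\<^bsub>\<Lambda> n\<^esub> h) xs = act n g (act n h xs)"
  by (simp add: \<pi>_mult perm_tuple_comp \<pi>_permutes)

lemma nth_act_apply:
  assumes "g \<in> carrier (\<Lambda> n)" "length xs = n" "i < n"
  shows "act n g xs ! \<pi> n g i = xs ! i"
  using assms \<pi>_less[OF assms(1,3)] permutes_inverses(2)[OF \<pi>_permutes[OF assms(1)]]
  by (simp add: nth_perm_tuple)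

lemma act_inv_act:
  "\<lbrakk>g \<in> carrier (\<Lambda> n); length xs = n\<rbrakk> \<Longrightarrow> act n (inv\<^bsub>\<Lambda> n\<^esub> g) (act n g xs) = xs"
  by (simp add: act_mult[symmetric] act_one)

lemma act_act_inv:
  "\<lbrakk>g \<in> carrier (\<Lambda> n); length xs = n\<rbrakk> \<Longrightarrow> act n g (act n (inv\<^bsub>\<Lambda> n\<^esub> g) xs) = xs"
  by (simp add: act_mult[symmetric] act_one)

text \<open>With \<open>xs\<close> the target tuple of a morphism, this turns the hom-sets of the
  wreath category, whose targets are shifted by \<open>g\<close>, into componentwise hom-sets with
  target \<open>g^-1\<close> acting on \<open>xs\<close>.\<close>

lemma nth_act_inv:
  assumes "g \<in> carrier (\<Lambda> n)" "length xs = n" "i < n"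
  shows "act n (inv\<^bsub>\<Lambda> n\<^esub> g) xs ! i = xs ! \<pi> n g i"
  using nth_act_apply[of g n "act n (inv\<^bsub>\<Lambda> n\<^esub> g) xs" i] assms by (simp add: act_act_inv)

text \<open>Acting by \<open>b\<close> is acting by \<open>a\<close> and then by
  \<open>b a^-1\<close>, which moves position \<open>i\<close> to its image. This is what makes the
  endpoints match when \<open>q p^-1\<close> is attached to a morphism from \<open>(p, xs)\<close>
  to \<open>(q, ys)\<close>.\<close>

lemma nth_act_shift:
  assumes "a \<in> carrier (\<Lambda> n)" "b \<in> carrier (\<Lambda> n)" "length xs = n" "i < n"
  shows "act n b xs ! \<pi> n (b \<otimes>\<^bsub>\<Lambda> n\<^esub> inv\<^bsub>\<Lambda> n\<^esub> a) i = act n a xs ! i"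
proof -
  have "act n b xs = act n (b \<otimes>\<^bsub>\<Lambda> n\<^esub> inv\<^bsub>\<Lambda> n\<^esub> a) (act n a xs)"
    using assms by (simp add: act_mult[symmetric] m_assoc)
  then show ?thesis
    using assms nth_act_apply[of "b \<otimes>\<^bsub>\<Lambda> n\<^esub> inv\<^bsub>\<Lambda> n\<^esub> a" n "act n a xs" i] by simp
qed

lemma set_act_subset:
  "\<lbrakk>g \<in> carrier (\<Lambda> n); length xs = n; set xs \<subseteq> S\<rbrakk> \<Longrightarrow> set (act n g xs) \<subseteq> S"
  using set_perm_tuple_subset[of "\<pi> n g" xs] by (auto simp: \<pi>_permutes)

section \<open>The wreath category and its parts of fixed length\<close>

abbreviation "W \<equiv> wreath_cat \<Lambda> \<pi> X"

lemma nth_Ob: "\<lbrakk>xs \<in> lists (Ob X); i < length xs\<rbrakk> \<Longrightarrow> xs ! i \<in> Ob X"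
  by (auto simp: lists_eq_set)

text \<open>Each law reduces to the same law in \<open>\<Lambda> n\<close> and, in each component,
  in \<open>X\<close>; the positions agree because \<open>\<pi> n\<close> is multiplicative.\<close>

lemma wreath_category: "category W"
proof
  fix xs assume "xs \<in> Ob W"
  then show "Ident W xs \<in> Mor W xs xs"
    by (auto simp: wreath_cat_def \<pi>_one X.Ident_closed)
next
  fix xs ys zs f g
  assume "xs \<in> Ob W" "ys \<in> Ob W" "zs \<in> Ob W" "f \<in> Mor W xs ys" "g \<in> Mor W ys zs"
  then show "Comp W xs ys zs g f \<in> Mor W xs zs"
    by (auto simp: wreath_cat_def Let_def \<pi>_mult \<pi>_less nth_Ob simp del: in_lists_conv_set
        split: if_splits intro!: X.Comp_closed)
next
  fix xs ys f assume "xs \<in> Ob W" "ys \<in> Ob W" "f \<in> Mor W xs ys"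
  then show "Comp W xs ys ys (Ident W ys) f = f" "Comp W xs xs ys f (Ident W xs) = f"
    by (auto simp: wreath_cat_def Let_def \<pi>_one \<pi>_less nth_Ob X.Comp_Ident_left
        X.Comp_Ident_right simp del: in_lists_conv_set split: if_splits intro!: nth_equalityI)
next
  fix ws xs ys zs f g h
  assume "ws \<in> Ob W" "xs \<in> Ob W" "ys \<in> Ob W" "zs \<in> Ob W"
    "f \<in> Mor W ws xs" "g \<in> Mor W xs ys" "h \<in> Mor W ys zs"
  then show "Comp W ws xs zs (Comp W xs ys zs h g) f = Comp W ws ys zs h (Comp W ws xs ys g f)"
    by (auto simp: wreath_cat_def Let_def \<pi>_mult \<pi>_less nth_Ob m_assoc
        simp del: in_lists_conv_set split: if_splits intro!: X.Comp_assoc)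
qed

definition W_deg where "W_deg n = W\<lparr>Ob := {xs \<in> Ob W. length xs = n}\<rparr>"

lemma W_deg_simps:
  "Ob (W_deg n) = {xs. set xs \<subseteq> Ob X \<and> length xs = n}"
  "Ident (W_deg n) = Ident W" "Comp (W_deg n) = Comp W"
  by (auto simp: W_deg_def wreath_cat_def)

lemma W_deg_Mor:
  "\<lbrakk>length xs = n; length ys = n\<rbrakk> \<Longrightarrow> (g, fs) \<in> Mor (W_deg n) xs ys \<longleftrightarrow>
    g \<in> carrier (\<Lambda> n) \<and> length fs = n \<and> (\<forall>i<n. fs ! i \<in> Mor X (xs ! i) (ys ! \<pi> n g i))"
  by (auto simp: W_deg_def wreath_cat_def)

lemma W_deg_category: "category (W_deg n)"
  unfolding W_deg_def by (rule category_full_subcat[OF wreath_category]) auto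


section \<open>Comparison with the coequalizer\<close>

lemma target_simps:
  "Ob (act_target \<Lambda> X n) = {(p, xs). p \<in> carrier (\<Lambda> n) \<and> length xs = n \<and> set xs \<subseteq> Ob X}"
  "Mor (act_target \<Lambda> X n) (p, xs) (q, ys) =
    {(u, fs). length fs = n \<and> (\<forall>i<n. fs ! i \<in> Mor X (xs ! i) (ys ! i))}"
  "Ident (act_target \<Lambda> X n) (p, xs) = ((), map (Ident X) xs)"
  "Comp (act_target \<Lambda> X n) (p, xs) (q, ys) (r, zs) (u, gs) (v, fs) =
    ((), map (\<lambda>i. Comp X (xs ! i) (ys ! i) (zs ! i) (gs ! i) (fs ! i)) [0..<n])"
  by (auto simp: act_target_def E_cat_def indiscrete_cat_def prod_cat_def power_cat_def)

lemma target_ObE: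
  assumes "x \<in> Ob (act_target \<Lambda> X n)"
  obtains p xs where "x = (p, xs)" "p \<in> carrier (\<Lambda> n)" "length xs = n" "set xs \<subseteq> Ob X"
  using assms by (cases x) (simp add: target_simps)

lemma target_MorE:
  assumes "f \<in> Mor (act_target \<Lambda> X n) (p, xs) (q, ys)"
  obtains fs where "f = ((), fs)" "length fs = n" "\<And>i. i < n \<Longrightarrow> fs ! i \<in> Mor X (xs ! i) (ys ! i)"
  using assms by (cases f) (simp add: target_simps)

lemma source_simps:
  "Ob (act_source \<Lambda> X n) =
    {(p, g, xs). p \<in> carrier (\<Lambda> n) \<and> g \<in> carrier (\<Lambda> n) \<and> length xs = n \<and> set xs \<subseteq> Ob X}"
  "Mor (act_source \<Lambda> X n) (p, g, xs) (q, h, ys) =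
    {(u, v, fs). g = h \<and> length fs = n \<and> (\<forall>i<n. fs ! i \<in> Mor X (xs ! i) (ys ! i))}"
  "Ident (act_source \<Lambda> X n) (p, g, xs) = ((), (), map (Ident X) xs)"
  "Comp (act_source \<Lambda> X n) (p, g, xs) (q, h, ys) (r, k, zs) (u, v, gs) (u', v', fs) =
    ((), (), map (\<lambda>i. Comp X (xs ! i) (ys ! i) (zs ! i) (gs ! i) (fs ! i)) [0..<n])"
  by (auto simp: act_source_def E_cat_def indiscrete_cat_def discrete_cat_def prod_cat_def
      power_cat_def split: if_splits)

lemma target_category: "category (act_target \<Lambda> X n)"
  unfolding act_target_def E_cat_def
  by (intro category_prod_cat category_power_cat category_indiscrete_cat X.category_axioms)

lemma source_category: "category (act_source \<Lambda> X n)"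
  unfolding act_source_def E_cat_def
  by (intro category_prod_cat category_power_cat category_indiscrete_cat category_discrete_cat
      X.category_axioms)

lemma right_act_functor: "cat_functor (act_source \<Lambda> X n) (act_target \<Lambda> X n) (right_act \<Lambda> n)"
  by (intro cat_functor.intro cat_functor_axioms.intro source_category target_category)
    (auto simp: source_simps target_simps right_act_def)

text \<open>The discrete middle factor forces the same \<open>g\<close> at both ends of a morphism,
  so the source, the target and the components are all permuted in the same way.\<close>

lemma left_act_functor: "cat_functor (act_source \<Lambda> X n) (act_target \<Lambda> X n) (left_act \<pi> n)"
proof (intro cat_functor.intro cat_functor_axioms.intro source_category target_category)
  fix x assume "x \<in> Ob (act_source \<Lambda> X n)"
  then obtain p g xs where x: "x = (p, g, xs)" "p \<in> carrier (\<Lambda> n)" "g \<in> carrier (\<Lambda> n)"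
      "length xs = n" "set xs \<subseteq> Ob X"
    by (auto simp: source_simps)
  then show "omap (left_act \<pi> n) x \<in> Ob (act_target \<Lambda> X n)"
    using set_act_subset[of g n xs "Ob X"] by (simp add: target_simps left_act_def)
  from x show "mmap (left_act \<pi> n) x x (Ident (act_source \<Lambda> X n) x) =
      Ident (act_target \<Lambda> X n) (omap (left_act \<pi> n) x)"
    by (simp add: source_simps target_simps left_act_def perm_tuple_map \<pi>_permutes)
next
  fix x y f
  assume "x \<in> Ob (act_source \<Lambda> X n)" "y \<in> Ob (act_source \<Lambda> X n)" "f \<in> Mor (act_source \<Lambda> X n) x y"
  then show "mmap (left_act \<pi> n) x y f \<in>
      Mor (act_target \<Lambda> X n) (omap (left_act \<pi> n) x) (omap (left_act \<pi> n) y)"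
    by (auto simp: source_simps target_simps left_act_def nth_perm_tuple
        inv_permutes_less \<pi>_permutes)
next
  fix x y z f g
  assume "x \<in> Ob (act_source \<Lambda> X n)" "y \<in> Ob (act_source \<Lambda> X n)" "z \<in> Ob (act_source \<Lambda> X n)"
    "f \<in> Mor (act_source \<Lambda> X n) x y" "g \<in> Mor (act_source \<Lambda> X n) y z"
  then show "mmap (left_act \<pi> n) x z (Comp (act_source \<Lambda> X n) x y z g f) =
      Comp (act_target \<Lambda> X n) (omap (left_act \<pi> n) x) (omap (left_act \<pi> n) y)
        (omap (left_act \<pi> n) z) (mmap (left_act \<pi> n) y z g) (mmap (left_act \<pi> n) x y f)"
    by (auto simp: source_simps target_simps left_act_def nth_perm_tuple
        inv_permutes_less \<pi>_permutes intro!: nth_equalityI)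
qed

end

section \<open>The coequalizer in a fixed arity\<close>

locale groups_over_perms_arity = groups_over_perms \<Lambda> \<pi> X
  for \<Lambda> :: "nat \<Rightarrow> 'a monoid" and \<pi> :: "nat \<Rightarrow> 'a \<Rightarrow> nat \<Rightarrow> nat" and X :: "('o, 'm) cat" +
  fixes n :: nat
begin

abbreviation "S \<equiv> act_source \<Lambda> X n"
abbreviation "T \<equiv> act_target \<Lambda> X n"

sublocale coeq: parallel_functors S T "right_act \<Lambda> n" "left_act \<pi> n"
  by (intro parallel_functors.intro right_act_functor left_act_functor)

lemma ob_act:
  assumes "p \<in> carrier (\<Lambda> n)" "g \<in> carrier (\<Lambda> n)" "length xs = n" "set xs \<subseteq> Ob X"
  shows "coeq.ob (p \<otimes>\<^bsub>\<Lambda> n\<^esub> g, xs) = coeq.ob (p, act n g xs)"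
  using coeq.ob_F_G[of "(p, g, xs)"] assms by (simp add: source_simps right_act_def left_act_def)

text \<open>This is the generating relation \<open>path_gen\<close> at the morphism
  \<open>fs\<close> from \<open>(p, g, xs)\<close> to \<open>(q, g, ys)\<close>: the right action
  keeps \<open>fs\<close>, the left action permutes it.\<close>

lemma mor_act:
  assumes "p \<in> carrier (\<Lambda> n)" "q \<in> carrier (\<Lambda> n)" "g \<in> carrier (\<Lambda> n)"
    and "length xs = n" "set xs \<subseteq> Ob X" "length ys = n" "set ys \<subseteq> Ob X"
    and "length fs = n" "\<And>i. i < n \<Longrightarrow> fs ! i \<in> Mor X (xs ! i) (ys ! i)"
  shows "coeq_path_eq S T (right_act \<Lambda> n) (left_act \<pi> n)
      (coeq.ob (p \<otimes>\<^bsub>\<Lambda> n\<^esub> g, xs)) (coeq.ob (q \<otimes>\<^bsub>\<Lambda> n\<^esub> g, ys))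
      [((p \<otimes>\<^bsub>\<Lambda> n\<^esub> g, xs), ((), fs), (q \<otimes>\<^bsub>\<Lambda> n\<^esub> g, ys))]
      [((p, act n g xs), ((), act n g fs), (q, act n g ys))]"
  using coeq_path_eq.path_gen[of "(p, g, xs)" S "(q, g, ys)" "((), (), fs)" T
      "right_act \<Lambda> n" "left_act \<pi> n"] assms
  by (simp add: source_simps right_act_def left_act_def)

text \<open>The component \<open>fs ! i\<close> moves to position \<open>\<pi> n p i\<close>,
  whereas its target entry moves to position \<open>\<pi> n q i\<close>; the element
  \<open>q p^-1\<close> relates the two.\<close>

definition collapse :: "('a \<times> 'o list, unit \<times> 'm list, 'o list, 'a \<times> 'm list) func" where
  "collapse =
    \<lparr>omap = (\<lambda>(p, xs). act n p xs),
     mmap = (\<lambda>(p, _) (q, _) (_ :: unit, fs). (q \<otimes>\<^bsub>\<Lambda> n\<^esub> inv\<^bsub>\<Lambda> n\<^esub> p, act n p fs))\<rparr>"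

text \<open>The arrow ends at \<open>g\<close> paired with \<open>g^-1\<close> acting on
  \<open>ys\<close>, so that its components have matching ends. This pair lies in the class of the
  unit paired with \<open>ys\<close>, which is why that class labels the target.\<close>

definition expand ::
    "('o list, 'a \<times> 'm list, ('a \<times> 'o list) set,
      (('a \<times> 'o list) \<times> (unit \<times> 'm list) \<times> ('a \<times> 'o list)) list set) func" where
  "expand =
    \<lparr>omap = (\<lambda>xs. coeq.ob (\<one>\<^bsub>\<Lambda> n\<^esub>, xs)),
     mmap = (\<lambda>xs ys (g, fs). coeq.mor (coeq.ob (\<one>\<^bsub>\<Lambda> n\<^esub>, xs)) (coeq.ob (\<one>\<^bsub>\<Lambda> n\<^esub>, ys))
       [((\<one>\<^bsub>\<Lambda> n\<^esub>, xs), ((), fs), (g, act n (inv\<^bsub>\<Lambda> n\<^esub> g) ys))])\<rparr>"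

lemma collapse_functor: "cat_functor T (W_deg n) collapse"
proof (intro cat_functor.intro cat_functor_axioms.intro target_category W_deg_category)
  fix x assume "x \<in> Ob T"
  then obtain p xs where x: "x = (p, xs)" "p \<in> carrier (\<Lambda> n)" "length xs = n" "set xs \<subseteq> Ob X"
    by (rule target_ObE)
  then show "omap collapse x \<in> Ob (W_deg n)"
    using set_act_subset[of p n xs "Ob X"] by (auto simp: collapse_def W_deg_simps)
  from x show "mmap collapse x x (Ident T x) = Ident (W_deg n) (omap collapse x)"
    by (simp add: collapse_def W_deg_simps target_simps wreath_cat_def perm_tuple_map \<pi>_permutes)
next
  fix x y f assume *: "x \<in> Ob T" "y \<in> Ob T" "f \<in> Mor T x y"
  obtain p xs where x: "x = (p, xs)" "p \<in> carrier (\<Lambda> n)" "length xs = n" "set xs \<subseteq> Ob X"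
    using *(1) by (rule target_ObE)
  obtain q ys where y: "y = (q, ys)" "q \<in> carrier (\<Lambda> n)" "length ys = n" "set ys \<subseteq> Ob X"
    using *(2) by (rule target_ObE)
  obtain fs where f: "f = ((), fs)" "length fs = n"
      "\<And>i. i < n \<Longrightarrow> fs ! i \<in> Mor X (xs ! i) (ys ! i)"
    using *(3)[unfolded x y] by (rule target_MorE) (rule that)
  show "mmap collapse x y f \<in> Mor (W_deg n) (omap collapse x) (omap collapse y)"
    using x y f
    by (simp add: collapse_def W_deg_Mor nth_act_shift nth_perm_tuple inv_permutes_less \<pi>_permutes)
next
  fix x y z f g
  assume *: "x \<in> Ob T" "y \<in> Ob T" "z \<in> Ob T" "f \<in> Mor T x y" "g \<in> Mor T y z"
  obtain p xs where x: "x = (p, xs)" "p \<in> carrier (\<Lambda> n)" "length xs = n" "set xs \<subseteq> Ob X"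
    using *(1) by (rule target_ObE)
  obtain q ys where y: "y = (q, ys)" "q \<in> carrier (\<Lambda> n)" "length ys = n" "set ys \<subseteq> Ob X"
    using *(2) by (rule target_ObE)
  obtain r zs where z: "z = (r, zs)" "r \<in> carrier (\<Lambda> n)" "length zs = n" "set zs \<subseteq> Ob X"
    using *(3) by (rule target_ObE)
  obtain fs where f: "f = ((), fs)" "length fs = n"
    using *(4)[unfolded x y] by (rule target_MorE) (rule that)
  obtain gs where g: "g = ((), gs)" "length gs = n"
    using *(5)[unfolded y z] by (rule target_MorE) (rule that)
  let ?g = "q \<otimes>\<^bsub>\<Lambda> n\<^esub> inv\<^bsub>\<Lambda> n\<^esub> p" and ?h = "r \<otimes>\<^bsub>\<Lambda> n\<^esub> inv\<^bsub>\<Lambda> n\<^esub> q"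
  have carrier: "?g \<in> carrier (\<Lambda> n)" "?h \<in> carrier (\<Lambda> n)"
    using x y z by simp_all
  \<comment> \<open>The group parts telescope: the middle factors \<open>q^-1 q\<close>
    cancel.\<close>
  have "?h \<otimes>\<^bsub>\<Lambda> n\<^esub> ?g = r \<otimes>\<^bsub>\<Lambda> n\<^esub> (inv\<^bsub>\<Lambda> n\<^esub> q \<otimes>\<^bsub>\<Lambda> n\<^esub> q) \<otimes>\<^bsub>\<Lambda> n\<^esub> inv\<^bsub>\<Lambda> n\<^esub> p"
    using x(2) y(2) z(2) by (simp only: m_assoc inv_closed m_closed)
  then have "r \<otimes>\<^bsub>\<Lambda> n\<^esub> inv\<^bsub>\<Lambda> n\<^esub> p = ?h \<otimes>\<^bsub>\<Lambda> n\<^esub> ?g"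
    using x(2) y(2) z(2) by simp
  \<comment> \<open>Shifting by \<open>?g\<close>, and then by \<open>?h\<close>, turns the entries
    permuted by \<open>q\<close> and \<open>r\<close> into those permuted by \<open>p\<close>, so at
    index \<open>i\<close> both sides are the composite at position \<open>p^-1 i\<close>.\<close>
  moreover have "act n p (map (\<lambda>i. Comp X (xs ! i) (ys ! i) (zs ! i) (gs ! i) (fs ! i)) [0..<n]) =
      map (\<lambda>i. Comp X (act n p xs ! i) (act n q ys ! \<pi> n ?g i) (act n r zs ! \<pi> n ?h (\<pi> n ?g i))
        (act n q gs ! \<pi> n ?g i) (act n p fs ! i)) [0..<n]"
    using x y z f g \<pi>_less[OF carrier(1)]
    by (intro nth_equalityI)
      (simp_all add: nth_act_shift, simp add: nth_perm_tuple inv_permutes_less \<pi>_permutes)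
  ultimately show "mmap collapse x z (Comp T x y z g f) =
      Comp (W_deg n) (omap collapse x) (omap collapse y) (omap collapse z)
        (mmap collapse y z g) (mmap collapse x y f)"
    using x y z f g
    by (simp add: collapse_def W_deg_simps target_simps wreath_cat_def Let_def)
qed

text \<open>On objects and on components this is the action law. On group parts, \<open>g\<close>
  cancels in \<open>(q g) (p g)^-1\<close>.\<close>

lemma collapse_coequalizes:
  "func_eq S (func_comp collapse (right_act \<Lambda> n)) (func_comp collapse (left_act \<pi> n))"
proof -
  have "q \<otimes>\<^bsub>\<Lambda> n\<^esub> g \<otimes>\<^bsub>\<Lambda> n\<^esub> inv\<^bsub>\<Lambda> n\<^esub> (p \<otimes>\<^bsub>\<Lambda> n\<^esub> g) = q \<otimes>\<^bsub>\<Lambda> n\<^esub> inv\<^bsub>\<Lambda> n\<^esub> p"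
    if "p \<in> carrier (\<Lambda> n)" "q \<in> carrier (\<Lambda> n)" "g \<in> carrier (\<Lambda> n)" for p q g
  proof -
    have "q \<otimes>\<^bsub>\<Lambda> n\<^esub> g \<otimes>\<^bsub>\<Lambda> n\<^esub> inv\<^bsub>\<Lambda> n\<^esub> (p \<otimes>\<^bsub>\<Lambda> n\<^esub> g) =
        q \<otimes>\<^bsub>\<Lambda> n\<^esub> (g \<otimes>\<^bsub>\<Lambda> n\<^esub> inv\<^bsub>\<Lambda> n\<^esub> g) \<otimes>\<^bsub>\<Lambda> n\<^esub> inv\<^bsub>\<Lambda> n\<^esub> p"
      using that by (simp only: m_assoc inv_closed m_closed inv_mult_group)
    then show ?thesis
      using that by simp
  qed
  then show ?thesis
    by (auto simp: func_eq_def func_comp_def source_simps collapse_def right_act_def left_act_def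
        act_mult)
qed

lemma ob_eq_ob_one:
  assumes "p \<in> carrier (\<Lambda> n)" "length xs = n" "set xs \<subseteq> Ob X"
  shows "coeq.ob (p, xs) = coeq.ob (\<one>\<^bsub>\<Lambda> n\<^esub>, act n p xs)"
  using ob_act[of "\<one>\<^bsub>\<Lambda> n\<^esub>" p xs] assms by simp

lemma ob_act_inv:
  assumes "g \<in> carrier (\<Lambda> n)" "length xs = n" "set xs \<subseteq> Ob X"
  shows "coeq.ob (g, act n (inv\<^bsub>\<Lambda> n\<^esub> g) xs) = coeq.ob (\<one>\<^bsub>\<Lambda> n\<^esub>, xs)"
  using assms by (subst ob_eq_ob_one) (simp_all add: set_act_subset act_act_inv)

lemma Mor_target_act_inv:
  assumes "xs \<in> Ob (W_deg n)" "ys \<in> Ob (W_deg n)" "(g, fs) \<in> Mor (W_deg n) xs ys"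
  shows "(\<one>\<^bsub>\<Lambda> n\<^esub>, xs) \<in> Ob T" "(g, act n (inv\<^bsub>\<Lambda> n\<^esub> g) ys) \<in> Ob T"
    "((), fs) \<in> Mor T (\<one>\<^bsub>\<Lambda> n\<^esub>, xs) (g, act n (inv\<^bsub>\<Lambda> n\<^esub> g) ys)"
    "g \<in> carrier (\<Lambda> n)"
  using assms
  by (simp_all add: W_deg_simps(1) W_deg_Mor target_simps nth_act_inv set_act_subset)

lemma path_expand:
  assumes "xs \<in> Ob (W_deg n)" "ys \<in> Ob (W_deg n)" "(g, fs) \<in> Mor (W_deg n) xs ys"
  shows "coeq.path (coeq.ob (\<one>\<^bsub>\<Lambda> n\<^esub>, xs)) (coeq.ob (\<one>\<^bsub>\<Lambda> n\<^esub>, ys))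
    [((\<one>\<^bsub>\<Lambda> n\<^esub>, xs), ((), fs), (g, act n (inv\<^bsub>\<Lambda> n\<^esub> g) ys))]"
  using coeq.path_singleton[OF Mor_target_act_inv(1-3)[OF assms]] Mor_target_act_inv(4)[OF assms]
    assms(2)
  by (simp add: ob_act_inv W_deg_simps(1))

text \<open>The two arrows meet only up to the identification of objects, so they cannot be composed
  in \<open>T\<close> as they stand. Translating the second one by \<open>g\<close> makes it start
  exactly where the first one ends; then \<open>path_Comp\<close> applies.\<close>

lemma path_eq_expand_Comp:
  assumes xs: "xs \<in> Ob (W_deg n)" and ys: "ys \<in> Ob (W_deg n)" and zs: "zs \<in> Ob (W_deg n)"
    and f: "(g, fs) \<in> Mor (W_deg n) xs ys" and h: "(h, gs) \<in> Mor (W_deg n) ys zs"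
  shows "coeq.path_eq (coeq.ob (\<one>\<^bsub>\<Lambda> n\<^esub>, xs)) (coeq.ob (\<one>\<^bsub>\<Lambda> n\<^esub>, zs))
    [((\<one>\<^bsub>\<Lambda> n\<^esub>, xs), ((), fs), (g, act n (inv\<^bsub>\<Lambda> n\<^esub> g) ys)),
     ((\<one>\<^bsub>\<Lambda> n\<^esub>, ys), ((), gs), (h, act n (inv\<^bsub>\<Lambda> n\<^esub> h) zs))]
    [((\<one>\<^bsub>\<Lambda> n\<^esub>, xs), ((), snd (Comp W xs ys zs (h, gs) (g, fs))),
      (h \<otimes>\<^bsub>\<Lambda> n\<^esub> g, act n (inv\<^bsub>\<Lambda> n\<^esub> (h \<otimes>\<^bsub>\<Lambda> n\<^esub> g)) zs))]"
proof -
  let ?ys = "act n (inv\<^bsub>\<Lambda> n\<^esub> g) ys" and ?gs = "act n (inv\<^bsub>\<Lambda> n\<^esub> g) gs"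
    and ?hg = "h \<otimes>\<^bsub>\<Lambda> n\<^esub> g"
  let ?zs = "act n (inv\<^bsub>\<Lambda> n\<^esub> ?hg) zs"
  have carrier: "g \<in> carrier (\<Lambda> n)" "h \<in> carrier (\<Lambda> n)" "?hg \<in> carrier (\<Lambda> n)"
    using Mor_target_act_inv(4)[OF xs ys f] Mor_target_act_inv(4)[OF ys zs h] by simp_all
  have len: "length xs = n" "length ys = n" "length zs = n" "length fs = n" "length gs = n"
    and sub: "set xs \<subseteq> Ob X" "set ys \<subseteq> Ob X" "set zs \<subseteq> Ob X"
    using xs ys zs f h by (simp_all add: W_deg_simps(1) W_deg_Mor)
  have obs: "coeq.ob (g, ?ys) = coeq.ob (\<one>\<^bsub>\<Lambda> n\<^esub>, ys)"
    "coeq.ob (?hg, ?zs) = coeq.ob (\<one>\<^bsub>\<Lambda> n\<^esub>, zs)"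
    using carrier len sub by (simp_all add: ob_act_inv)
  \<comment> \<open>The translated components are those of \<open>gs\<close> at the shifted
    positions, hence they lead to the entries of \<open>zs\<close> shifted by
    \<open>h g\<close>.\<close>
  have gs: "?gs ! i \<in> Mor X (?ys ! i) (?zs ! i)" if "i < n" for i
  proof -
    have "gs ! \<pi> n g i \<in> Mor X (ys ! \<pi> n g i) (zs ! \<pi> n h (\<pi> n g i))"
      using h len carrier that by (simp add: W_deg_Mor \<pi>_less)
    then show ?thesis
      using carrier len that nth_act_inv[OF carrier(3) len(3) that]
      by (simp add: nth_act_inv \<pi>_mult)
  qed
  \<comment> \<open>Since \<open>g (h g)^-1 = h^-1\<close>, undoing the translation gives back the
    target of the second arrow.\<close>
  have "act n g ?zs = act n (inv\<^bsub>\<Lambda> n\<^esub> h) zs"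
    using carrier len
    by (simp add: act_mult[symmetric] inv_mult_group m_assoc[symmetric])
  then have shift: "coeq.path_eq (coeq.ob (\<one>\<^bsub>\<Lambda> n\<^esub>, ys)) (coeq.ob (\<one>\<^bsub>\<Lambda> n\<^esub>, zs))
      [((\<one>\<^bsub>\<Lambda> n\<^esub>, ys), ((), gs), (h, act n (inv\<^bsub>\<Lambda> n\<^esub> h) zs))]
      [((g, ?ys), ((), ?gs), (?hg, ?zs))]"
    using mor_act[of "\<one>\<^bsub>\<Lambda> n\<^esub>" h g ?ys ?zs ?gs] gs carrier len sub
    by - (rule path_sym, simp add: set_act_subset act_act_inv obs)
  have "?gs ! i = gs ! \<pi> n g i" "?ys ! i = ys ! \<pi> n g i" "?zs ! i = zs ! \<pi> n h (\<pi> n g i)"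
    if "i < n" for i
    using nth_act_inv[OF carrier(1) _ that] nth_act_inv[OF carrier(3) len(3) that] carrier len
    by (simp_all add: \<pi>_mult)
  then have Comp_eq: "Comp T (\<one>\<^bsub>\<Lambda> n\<^esub>, xs) (g, ?ys) (?hg, ?zs) ((), ?gs) ((), fs) =
      ((), snd (Comp W xs ys zs (h, gs) (g, fs)))"
    using len by (simp add: target_simps wreath_cat_def Let_def)
  have "coeq.path_eq (coeq.ob (\<one>\<^bsub>\<Lambda> n\<^esub>, xs)) (coeq.ob (?hg, ?zs))
      [((\<one>\<^bsub>\<Lambda> n\<^esub>, xs), ((), fs), (g, ?ys)), ((g, ?ys), ((), ?gs), (?hg, ?zs))]
      [((\<one>\<^bsub>\<Lambda> n\<^esub>, xs), Comp T (\<one>\<^bsub>\<Lambda> n\<^esub>, xs) (g, ?ys) (?hg, ?zs) ((), ?gs) ((), fs), (?hg, ?zs))]"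
    using Mor_target_act_inv[OF xs ys f] gs carrier len sub
    by (intro path_Comp) (simp_all add: target_simps set_act_subset)
  moreover have "coeq.path_eq (coeq.ob (\<one>\<^bsub>\<Lambda> n\<^esub>, xs)) (coeq.ob (\<one>\<^bsub>\<Lambda> n\<^esub>, zs))
      [((\<one>\<^bsub>\<Lambda> n\<^esub>, xs), ((), fs), (g, ?ys)),
       ((\<one>\<^bsub>\<Lambda> n\<^esub>, ys), ((), gs), (h, act n (inv\<^bsub>\<Lambda> n\<^esub> h) zs))]
      [((\<one>\<^bsub>\<Lambda> n\<^esub>, xs), ((), fs), (g, ?ys)), ((g, ?ys), ((), ?gs), (?hg, ?zs))]"
    using path_append[OF path_refl[OF path_expand[OF xs ys f]] shift] by simp
  ultimately show ?thesis
    unfolding Comp_eq obs by (rule path_trans[rotated])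
qed

lemma expand_functor: "cat_functor (W_deg n) coeq.Q expand"
proof (intro cat_functor.intro cat_functor_axioms.intro W_deg_category coeq.coeq_category)
  fix xs assume xs: "xs \<in> Ob (W_deg n)"
  then show "omap expand xs \<in> Ob coeq.Q"
    by (simp add: expand_def coeq.Ob_Q W_deg_simps(1) target_simps)
  have "(\<one>\<^bsub>\<Lambda> n\<^esub>, xs) \<in> Ob T"
    using xs by (simp add: W_deg_simps(1) target_simps)
  then show "mmap expand xs xs (Ident (W_deg n) xs) = Ident coeq.Q (omap expand xs)"
    using coeq.mor_eqD[OF path_Ident[of "(\<one>\<^bsub>\<Lambda> n\<^esub>, xs)"]] xs
    by (simp add: expand_def coeq_cat_def W_deg_simps wreath_cat_def target_simps act_one)
next
  fix xs ys f
  assume *: "xs \<in> Ob (W_deg n)" "ys \<in> Ob (W_deg n)" "f \<in> Mor (W_deg n) xs ys"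
  obtain g fs where "f = (g, fs)" by fastforce
  with * show "mmap expand xs ys f \<in> Mor coeq.Q (omap expand xs) (omap expand ys)"
    by (simp add: expand_def coeq.mor_in_Q path_expand)
next
  fix xs ys zs f f'
  assume *: "xs \<in> Ob (W_deg n)" "ys \<in> Ob (W_deg n)" "zs \<in> Ob (W_deg n)"
    "f \<in> Mor (W_deg n) xs ys" "f' \<in> Mor (W_deg n) ys zs"
  obtain g fs h gs where f: "f = (g, fs)" "f' = (h, gs)" by fastforce
  \<comment> \<open>\<open>path_eq_expand_Comp\<close> spells out the group part of the composite,
    so it is matched with \<open>Comp\<close> here.\<close>
  have "fst (Comp W xs ys zs f' f) = h \<otimes>\<^bsub>\<Lambda> n\<^esub> g"
    using *(1) f by (simp add: wreath_cat_def Let_def W_deg_simps(1))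
  then show "mmap expand xs zs (Comp (W_deg n) xs ys zs f' f) =
      Comp coeq.Q (omap expand xs) (omap expand ys) (omap expand zs)
        (mmap expand ys zs f') (mmap expand xs ys f)"
    using * f coeq.mor_eqD[OF path_eq_expand_Comp[of xs ys zs g fs h gs]]
    by (simp add: expand_def W_deg_simps coeq.Comp_mor[OF path_expand path_expand] split_beta)
qed

text \<open>Checked on representatives only; the universal property carries it over to the
  coequalizer. On morphisms, \<open>mor_act\<close> with the elements \<open>1\<close>,
  \<open>q p^-1\<close> and \<open>p\<close> moves the arrow from \<open>(p, xs)\<close> to one that
  starts over the unit.\<close>

lemma expand_collapse: "func_eq T (func_comp expand collapse) coeq.proj"
  unfolding func_eq_def
proof (intro conjI ballI)
  fix x assume "x \<in> Ob T"
  then obtain p xs where "x = (p, xs)" "p \<in> carrier (\<Lambda> n)" "length xs = n" "set xs \<subseteq> Ob X"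
    by (rule target_ObE)
  then show "omap (func_comp expand collapse) x = omap coeq.proj x"
    by (simp add: func_comp_def expand_def collapse_def coeq_proj_def ob_eq_ob_one)
next
  fix x y f assume *: "x \<in> Ob T" "y \<in> Ob T" "f \<in> Mor T x y"
  obtain p xs where x: "x = (p, xs)" "p \<in> carrier (\<Lambda> n)" "length xs = n" "set xs \<subseteq> Ob X"
    using *(1) by (rule target_ObE)
  obtain q ys where y: "y = (q, ys)" "q \<in> carrier (\<Lambda> n)" "length ys = n" "set ys \<subseteq> Ob X"
    using *(2) by (rule target_ObE)
  obtain fs where f: "f = ((), fs)" "length fs = n"
      "\<And>i. i < n \<Longrightarrow> fs ! i \<in> Mor X (xs ! i) (ys ! i)"
    using *(3)[unfolded x y] by (rule target_MorE) (rule that)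
  let ?g = "q \<otimes>\<^bsub>\<Lambda> n\<^esub> inv\<^bsub>\<Lambda> n\<^esub> p"
  have g: "?g \<in> carrier (\<Lambda> n)" "?g \<otimes>\<^bsub>\<Lambda> n\<^esub> p = q"
    using x y by (simp_all add: m_assoc)
  have "act n q ys = act n ?g (act n p ys)"
    using x y g by (simp add: act_mult[symmetric])
  then have "act n (inv\<^bsub>\<Lambda> n\<^esub> ?g) (act n q ys) = act n p ys"
    using y g by (simp add: act_inv_act)
  then show "mmap (func_comp expand collapse) x y f = mmap coeq.proj x y f"
    using coeq.mor_eqD[OF mor_act[of "\<one>\<^bsub>\<Lambda> n\<^esub>" ?g p xs ys fs]] x y f g
    by (simp add: func_comp_def expand_def collapse_def coeq_proj_def ob_eq_ob_one)
qed

lemma tensor_isomorphic: "cat_isomorphic (E_tensor \<Lambda> \<pi> X n) (W_deg n)"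
proof -
  obtain K where K: "cat_functor coeq.Q (W_deg n) K" "func_eq T (func_comp K coeq.proj) collapse"
    using coeq.coeq_universal[OF collapse_functor collapse_coequalizes] by metis
  have K_ob: "omap K (coeq.ob x) = omap collapse x" if "x \<in> Ob T" for x
    using K(2) that by (simp add: func_eq_def func_comp_def coeq_proj_def)
  have K_mor: "mmap K (coeq.ob x) (coeq.ob y) (coeq.mor (coeq.ob x) (coeq.ob y) [(x, f, y)]) =
      mmap collapse x y f" if "x \<in> Ob T" "y \<in> Ob T" "f \<in> Mor T x y" for x y f
    using K(2) that by (simp add: func_eq_def func_comp_def coeq_proj_def)
  have "func_eq (W_deg n) (func_comp K expand) func_id"
    unfolding func_eq_def
  proof (intro conjI ballI)
    fix xs assume "xs \<in> Ob (W_deg n)"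
    then show "omap (func_comp K expand) xs = omap func_id xs"
      by (simp add: func_comp_def func_id_def expand_def K_ob target_simps W_deg_simps(1)
          collapse_def act_one)
  next
    fix xs ys f
    assume *: "xs \<in> Ob (W_deg n)" "ys \<in> Ob (W_deg n)" "f \<in> Mor (W_deg n) xs ys"
    obtain g fs where f: "f = (g, fs)" by fastforce
    note M = Mor_target_act_inv[OF *[unfolded f]]
    \<comment> \<open>\<open>K_mor\<close> evaluates a class labelled by the endpoints of its arrow;
      this equation adapts the label used in \<open>expand\<close>.\<close>
    have "coeq.ob (g, act n (inv\<^bsub>\<Lambda> n\<^esub> g) ys) = coeq.ob (\<one>\<^bsub>\<Lambda> n\<^esub>, ys)"
      using M(4) *(2) by (simp add: ob_act_inv W_deg_simps(1))
    then show "mmap (func_comp K expand) xs ys f = mmap func_id xs ys f"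
      using K_mor[OF M(1-3)] M(4) f
      by (simp add: func_comp_def func_id_def expand_def collapse_def act_one)
  qed
  moreover have "func_eq coeq.Q (func_comp expand K) func_id"
  proof -
    have "func_eq T (func_comp (func_comp expand K) coeq.proj) coeq.proj"
      using K(2) expand_collapse by (simp add: func_eq_def func_comp_def)
    moreover have "func_eq T (func_comp func_id coeq.proj) coeq.proj"
      by (simp add: func_eq_def func_comp_def func_id_def)
    \<comment> \<open>The universal property of the projection itself: \<open>expand\<close> after
      \<open>K\<close> and the identity both extend it, so both agree with the same
      \<open>K'\<close>.\<close>
    moreover obtain K' where "\<And>G. \<lbrakk>cat_functor coeq.Q coeq.Q G;
        func_eq T (func_comp G coeq.proj) coeq.proj\<rbrakk> \<Longrightarrow> func_eq coeq.Q G K'"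
      using coeq.coeq_universal[OF coeq.proj_functor coeq.proj_coequalizes] by metis
    ultimately have "func_eq coeq.Q (func_comp expand K) K'" "func_eq coeq.Q func_id K'"
      using cat_functor_comp[OF K(1) expand_functor] cat_functor_id[OF coeq.coeq_category]
      by blast+
    then show ?thesis
      by (simp add: func_eq_def)
  qed
  ultimately show ?thesis
    unfolding E_tensor_def cat_isomorphic_def using K(1) expand_functor by blast
qed

end

section \<open>Assembling all arities\<close>

context groups_over_perms
begin

lemma free_cat_isomorphic: "cat_isomorphic (free_cat \<Lambda> \<pi> X) W"
proof -
  interpret groups_over_perms_arity \<Lambda> \<pi> X n for n
    by (intro groups_over_perms_arity.intro groups_over_perms_axioms)
  \<comment> \<open>The degree is the length of a tuple, and hom-sets between tuples of different
    lengths are empty.\<close>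
  have "cat_isomorphic (coprod_cat W_deg) W"
    unfolding W_deg_def
    by (rule coprod_graded_isomorphic[OF wreath_category])
      (auto simp: wreath_cat_def split: if_splits)
  then show ?thesis
    unfolding free_cat_def
    using cat_isomorphic_trans cat_isomorphic_coprod[of "E_tensor \<Lambda> \<pi> X" W_deg]
      tensor_isomorphic by blast
qed

end

theorem proposition12p20:
  fixes L :: "'a operad" and \<Lambda> :: "nat \<Rightarrow> 'a monoid" and \<pi> :: "nat \<Rightarrow> 'a \<Rightarrow> nat \<Rightarrow> nat"
    and X :: "('o, 'm) cat"
  assumes "action_operad L \<Lambda> \<pi>" and "category X"
  shows "\<exists>C :: ('o list, 'a \<times> 'm list) cat.
    category C \<and>
    Ob C = lists (Ob X) \<and>
    (\<forall>xs\<in>lists (Ob X). \<forall>ys\<in>lists (Ob X). Mor C xs ys =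
      (if length xs \<noteq> length ys then {}
       else SIGMA g:carrier (\<Lambda> (length xs)).
         {fs. length fs = length xs \<and>
           (\<forall>i<length xs. fs ! i \<in> Mor X (xs ! i) (ys ! \<pi> (length xs) g i))})) \<and>
    cat_isomorphic (free_cat \<Lambda> \<pi> X) C"
proof -
  interpret action_operad L \<Lambda> \<pi> by fact
  interpret category X by fact
  interpret groups_over_perms \<Lambda> \<pi> X
    by (intro groups_over_perms.intro groups_over_perms_axioms.intro category_axioms group_\<Lambda> \<pi>_hom)
  show ?thesis
    \<comment> \<open>The witness is the wreath category, whose objects and hom-sets are the
      required ones by definition.\<close>
    by (rule exI[of _ W])
      (simp only: wreath_category free_cat_isomorphic, simp add: wreath_cat_def)
qed

end
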